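(* (1) If $q=2^n$ with $n$ even, then every maximal clique of $\Gamma$ has size $q$ or $4$; when $q>4$, the maximal cliques of size $q$ are linear and the maximal cliques of size $4$ are non-linear. (2) If $q=2^n>2$ with $n$ odd, then every maximal clique of $\Gamma$ has size $q$ or $6$; the cliques of size $q$ are linear and the maximal cliques of size $6$ are non-linear. (3) For every $q$, every non-linear $3$-clique of $\Gamma$ is contained in exactly $q+1$ non-linear $4$-cliques. (4) If $n$ is odd, then every non-linear $4$-clique is contained in exactly two $5$-cliques of $\Gamma$, and every non-linear $5$-clique is contained in exactly one $6$-clique of $\Gamma$.
   Context: Let $q=2^n$ and let $Q_0\cong Q(4,q)$ be the parabolic quadric generalized quadrangle in $\mathrm{PG}(4,q)$. An elliptic ovoid of $Q_0$ is a set $X=S\cap Q_0$ where $S$ is a $3$-dimensional projective subspace meeting $Q_0$ in an elliptic quadric $Q^-(3,q)$. Two distinct elliptic ovoids meet in one point (then they are tangent) or in a conic. A rosette based at $p\in Q_0$ is a set of $q$ elliptic ovoids pairwise meeting exactly in $\{p\}$. $\Gamma$ is the graph whose vertices are the elliptic ovoids of $Q_0$, adjacent iff distinct and tangent. A clique of $\Gamma$ is linear if it is contained in some rosette, non-linear otherwise; an $i$-clique is a clique with $i$ vertices. *)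

theory Defs
  imports "HOL-Analysis.Finite_Cartesian_Product"
begin

text \<open>Vectors of the underlying 5-dimensional space GF(q)^5 are elements of type 'a^5.
  The parabolic quadric Q(4,q) is taken in its standard form
  X0^2 + X1 X2 + X3 X4 = 0 (every parabolic quadric of PG(4,q) is projectively
  equivalent to it).\<close>

definition smult :: "'a::times \<Rightarrow> 'a^5 \<Rightarrow> 'a^5" where
  "smult c v = (\<chi> i. c * v$i)"

definition vadd :: "'a::plus^5 \<Rightarrow> 'a^5 \<Rightarrow> 'a^5" where
  "vadd x y = (\<chi> i. x$i + y$i)"

definition Qform :: "'a::comm_ring_1^5 \<Rightarrow> 'a" where
  "Qform v = v$0 * v$0 + v$1 * v$2 + v$3 * v$4"

definition polar :: "'a::comm_ring_1^5 \<Rightarrow> 'a^5 \<Rightarrow> 'a" where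
  "polar x y = Qform (vadd x y) - Qform x - Qform y"

text \<open>Points of PG(4,q): one-dimensional subspaces, represented by the set of their
  nonzero vectors.\<close>
definition proj_pt :: "'a::field^5 \<Rightarrow> ('a^5) set" where
  "proj_pt v = {smult c v | c. c \<noteq> 0}"

definition hyp :: "'a::field^5 \<Rightarrow> ('a^5) set" where
  "hyp a = {v. (\<Sum>i\<in>UNIV. a$i * v$i) = 0}"

definition Q0_points :: "('a::field^5) set set" where
  "Q0_points = {proj_pt v | v. v \<noteq> 0 \<and> Qform v = 0}"

text \<open>The solid with coordinates a meets Q0 in an elliptic quadric Q^-(3,q):
  the restriction of the quadratic form to the 4-dimensional subspace is
  nonsingular (its polar form is nondegenerate there) and of elliptic type,
  i.e. it contains no line (no totally singular 2-dimensional subspace).\<close>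
definition elliptic_solid :: "'a::field^5 \<Rightarrow> bool" where
  "elliptic_solid a \<longleftrightarrow> a \<noteq> 0 \<and>
     (\<forall>x\<in>hyp a. (\<forall>y\<in>hyp a. polar x y = 0) \<longrightarrow> x = 0) \<and>
     \<not> (\<exists>x y. x \<in> hyp a \<and> y \<in> hyp a \<and> x \<noteq> 0 \<and> (\<forall>c. y \<noteq> smult c x) \<and>
             Qform x = 0 \<and> Qform y = 0 \<and> polar x y = 0)"

definition ovoid_of :: "'a::field^5 \<Rightarrow> ('a^5) set set" where
  "ovoid_of a = {proj_pt v | v. v \<noteq> 0 \<and> v \<in> hyp a \<and> Qform v = 0}"

definition elliptic_ovoid :: "('a::field^5) set set \<Rightarrow> bool" where
  "elliptic_ovoid X \<longleftrightarrow> (\<exists>a. elliptic_solid a \<and> X = ovoid_of a)"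

definition adjacent :: "('a::field^5) set set \<Rightarrow> ('a^5) set set \<Rightarrow> bool" where
  "adjacent X Y \<longleftrightarrow> elliptic_ovoid X \<and> elliptic_ovoid Y \<and> X \<noteq> Y \<and> card (X \<inter> Y) = 1"

definition clique :: "('a::field^5) set set set \<Rightarrow> bool" where
  "clique C \<longleftrightarrow> (\<forall>X\<in>C. elliptic_ovoid X) \<and> (\<forall>X\<in>C. \<forall>Y\<in>C. X \<noteq> Y \<longrightarrow> adjacent X Y)"

definition kclique :: "nat \<Rightarrow> ('a::field^5) set set set \<Rightarrow> bool" where
  "kclique k C \<longleftrightarrow> clique C \<and> finite C \<and> card C = k"

definition maximal_clique :: "('a::field^5) set set set \<Rightarrow> bool" where
  "maximal_clique C \<longleftrightarrow> clique C \<and> (\<forall>D. clique D \<and> C \<subseteq> D \<longrightarrow> D = C)"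

definition rosette :: "('a::{field,finite}^5) set \<Rightarrow> ('a^5) set set set \<Rightarrow> bool" where
  "rosette p R \<longleftrightarrow> p \<in> Q0_points \<and> (\<forall>X\<in>R. elliptic_ovoid X) \<and> finite R \<and>
     card R = CARD('a) \<and> (\<forall>X\<in>R. \<forall>Y\<in>R. X \<noteq> Y \<longrightarrow> X \<inter> Y = {p})"

definition linear_clique :: "('a::{field,finite}^5) set set set \<Rightarrow> bool" where
  "linear_clique C \<longleftrightarrow> clique C \<and> (\<exists>p R. rosette p R \<and> C \<subseteq> R)"

end

theory Submission
  imports "HOL-Computational_Algebra.Polynomial" "HOL-Library.Product_Plus" Defs
begin

text \<open>Let \<open>Q x = x1 x2 + x3 x4\<close>, with polar form \<open>B\<close>. In characteristic two an elliptic solid is a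
  hyperplane \<open>X0 = B a x\<close> whose induced form \<open>Q x + (B a x)\<^sup>2\<close> is elliptic, and its ovoid is
  the set of singular points of that form. The neighbours of the ovoid of \<open>a\<close> are the
  ovoids of \<open>a + d\<close> for \<open>d \<noteq> 0\<close> singular with respect to the induced form. The neighbours
  \<open>a + d\<close> and \<open>a + e\<close> are adjacent iff \<open>B d e\<close> is 0 (then \<open>e\<close> is a multiple of \<open>d\<close> and the
  three ovoids lie in a rosette) or 1. Hence a non-linear clique through \<open>a\<close> is a set of singular
  vectors with all products equal to 1. Given \<open>d\<close> and \<open>e\<close>, a further member is
  \<open>d + e + w\<close> with \<open>w\<close> of norm 1 in the anisotropic plane orthogonal to \<open>d\<close> and \<open>e\<close>, which
  leaves \<open>q + 1\<close> choices. Given such a \<open>w\<close>, the next member comes from an equation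
  \<open>z\<^sup>2 + z = 1 + k\<close>, where anisotropy says that \<open>k\<close> is not of the form \<open>z\<^sup>2 + z\<close>. The elements
  of this form are an additive subgroup of index 2, which contains 1 iff \<open>n\<close> is even. So the
  equation has no solution for even \<open>n\<close>, and for odd \<open>n\<close> it has two, which are adjacent to
  each other.\<close>

section \<open>Finite fields of characteristic two\<close>

text \<open>The shift by 1 permutes the field, so the number of its elements, a power of two,
  vanishes in the field.\<close>

lemma one_plus_one_eq_0:
  assumes "CARD('a::{field,finite}) = 2 ^ n"
  shows "(1::'a) + 1 = 0"
proof -
  have "(\<Sum>x\<in>UNIV. x + 1) = (\<Sum>x\<in>UNIV. x::'a)"
    by (rule sum.reindex_bij_witness[of _ "\<lambda>x. x - 1" "\<lambda>x. x + 1"]) auto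
  hence "of_nat (2 ^ n) = (0::'a)"
    by (simp add: sum.distrib assms)
  thus ?thesis by simp
qed

text \<open>Multiplication by \<open>x\<close> permutes the nonzero elements; compare their products
  before and after.\<close>

lemma power_card_minus_one_eq_1:
  fixes x :: "'a::{field,finite}"
  assumes "x \<noteq> 0"
  shows "x ^ (CARD('a) - 1) = 1"
proof -
  have "(\<Prod>y\<in>UNIV-{0}. x * y) = (\<Prod>y\<in>UNIV-{0}. y)"
    by (rule prod.reindex_bij_witness[of _ "\<lambda>y. y / x" "\<lambda>y. x * y"]) (use assms in auto)
  thus ?thesis by (simp add: prod.distrib card_Diff_singleton)
qed

lemma two_power_mod_3: "(2::nat) ^ n mod 3 = (if even n then 1 else 2)"
proof (induction n)
  case (Suc n)
  have "(2::nat) ^ Suc n mod 3 = 2 * (2 ^ n mod 3) mod 3"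
    by (simp add: mod_mult_right_eq)
  thus ?case using Suc by simp
qed auto

text \<open>This is the image of the Artin-Schreier map; in a finite field of characteristic two it
  is the set of elements of absolute trace 0.\<close>

definition AS :: "'a::{plus,power} set" where
  "AS = range (\<lambda>x. x^2 + x)"

lemma AS_I [intro]: "x^2 + x \<in> AS"
  by (simp add: AS_def)

lemma AS_E: "y \<in> AS \<Longrightarrow> (\<And>x. y = x^2 + x \<Longrightarrow> P) \<Longrightarrow> P"
  by (auto simp: AS_def)

text \<open>A solution of \<open>w^2 + w = 1\<close> is a primitive cube root of unity, and such a
  root exists iff 3 divides \<open>2^n - 1\<close>.\<close>

lemma one_in_artin_schreier_iff:
  assumes "CARD('a::{field,finite}) = 2 ^ n"
  shows "(1::'a) \<in> AS \<longleftrightarrow> even n"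
proof
  have two: "(1::'a) + 1 = 0" by (rule one_plus_one_eq_0[OF assms])
  hence dbl: "x + x = 0" for x :: 'a by (metis distrib_left mult.right_neutral mult_zero_right)
  {
    assume "(1::'a) \<in> AS"
    then obtain w :: 'a where w: "w^2 + w = 1" by (auto simp: AS_def)
    have w0: "w \<noteq> 0" using w by auto
    have w2: "w^2 = w + 1" using w dbl by (metis add.commute add.left_commute add.right_neutral)
    have w3: "w^3 = 1"
    proof -
      have "w^3 = w * w^2" by (simp add: power3_eq_cube power2_eq_square)
      also have "\<dots> = w^2 + w" by (subst w2) (simp add: algebra_simps power2_eq_square)
      finally show ?thesis using w by simp
    qed
    show "even n"
    proof (rule ccontr)
      assume "odd n"
      hence "(2::nat) ^ n mod 3 = 2" by (simp add: two_power_mod_3)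
      then obtain k where "(2::nat) ^ n = 3 * k + 2" by (metis mult_div_mod_eq)
      hence "CARD('a) - 1 = 3 * k + 1" using assms by simp
      hence "w = 1" using power_card_minus_one_eq_1[OF w0] w3 by (simp add: power_mult)
      thus False using w dbl by simp
    qed
  }
  {
    assume "even n"
    hence "(2::nat) ^ n mod 3 = 1" by (simp add: two_power_mod_3)
    then obtain k where "(2::nat) ^ n = 3 * k + 1" by (metis mult_div_mod_eq)
    hence k: "CARD('a) = 3 * k + 1" using assms by simp
    have "CARD('a) > 1" using card_mono[of UNIV "{0::'a,1}"] by simp
    hence kpos: "k > 0" using k by simp
    \<comment> \<open>\<open>X^k - 1\<close> has at most \<open>k\<close> roots among the
      \<open>3 * k\<close> nonzero elements, so some \<open>y\<close> has \<open>y^k\<close>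
      different from 1; this power is a nontrivial cube root of unity.\<close>
    define p where "p = monom (1::'a) k - 1"
    have cp: "coeff p k = 1" using kpos by (simp add: p_def)
    hence p0: "p \<noteq> 0" by auto
    have "degree p \<le> k" unfolding p_def by (intro degree_diff_le degree_monom_le) auto
    hence cr: "card {y. poly p y = 0} \<le> k" using card_poly_roots_bound[OF p0] by linarith
    have "\<exists>y. y \<noteq> 0 \<and> poly p y \<noteq> 0"
    proof (rule ccontr)
      assume "\<not> ?thesis"
      hence "UNIV - {0} \<subseteq> {y. poly p y = 0}" by auto
      hence "card (UNIV - {0::'a}) \<le> k" using cr card_mono[of "{y. poly p y = 0}" "UNIV - {0}"] by simp
      thus False using k kpos by (simp add: card_Diff_singleton)
    qed
    then obtain y where "y \<noteq> 0" "poly p y \<noteq> 0" by blast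
    hence y: "y \<noteq> 0" "y ^ k \<noteq> 1" by (simp_all add: p_def poly_monom)
    define w where "w = y ^ k"
    have "w ^ 3 = y ^ (k * 3)" unfolding w_def by (rule power_mult [symmetric])
    also have "k * 3 = CARD('a) - 1" using k by simp
    finally have "w ^ 3 = 1" using power_card_minus_one_eq_1[OF y(1)] by simp
    hence "(w - 1) * (w^2 + w + 1) = 0" by (simp add: algebra_simps power3_eq_cube power2_eq_square)
    hence "w^2 + w + 1 = 0" using y by (simp add: w_def)
    hence "w^2 + w = 1" using dbl[of 1] by (metis add_right_cancel)
    hence "1 = (\<lambda>x. x^2 + x) w" by simp
    thus "(1::'a) \<in> AS" unfolding AS_def by (rule range_eqI)
  }
qed

section \<open>Arithmetic in characteristic two and the Artin-Schreier subgroup\<close>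

locale char2_field =
  fixes dummy :: "'a::{field,finite} itself"
  assumes char2: "(1::'a) + 1 = 0"
begin

lemma add_self [simp]: "x + x = (0::'a)"
  by (metis char2 distrib_left mult.right_neutral mult_zero_right)

lemma add_self_left [simp]: "x + (x + y) = (y::'a)"
  by (simp add: add.assoc [symmetric])

lemma uminus_eq [simp]: "- x = (x::'a)"
  by (rule minus_unique) simp

lemma minus_eq [simp]: "x - y = x + (y::'a)"
  by (simp add: diff_conv_add_uminus del: add_uminus_conv_diff)

lemma two_eq_0 [simp]: "(2::'a) = 0"
  using char2 unfolding one_add_one .

lemma sum_eq_0_iff [simp]: "x + y = 0 \<longleftrightarrow> x = (y::'a)"
  by (metis add_self add_self_left add.right_neutral)

lemma square_sum: "(x + y)^2 = x^2 + (y::'a)^2"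
  by (simp add: power2_eq_square algebra_simps)

lemma square_inj: "x^2 = y^2 \<Longrightarrow> x = (y::'a)"
  by (metis sum_eq_0_iff square_sum power2_eq_square mult_eq_0_iff)

text \<open>Squaring is an injective map of a finite set to itself. The square roots serve later to
  normalise vectors and to cancel norms.\<close>

lemma square_surj: "\<exists>r::'a. r^2 = x"
proof -
  have "surj (\<lambda>r::'a. r^2)"
    by (rule finite_UNIV_inj_surj) (auto intro: injI square_inj)
  thus ?thesis by (metis surjD)
qed

lemma square_eq_self: "x^2 = x \<longleftrightarrow> x = 0 \<or> x = (1::'a)"
  by (auto simp: power2_eq_square)

text \<open>The map is additive with kernel {0, 1}.\<close>

lemma AS_fibre: "x^2 + x = y^2 + y \<longleftrightarrow> x = y \<or> x = y + (1::'a)"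
proof -
  have "x^2 + x = y^2 + y \<longleftrightarrow> (x + y)^2 = x + y"
    using sum_eq_0_iff[of "x^2 + x" "y^2 + y"] sum_eq_0_iff[of "(x + y)^2" "x + y"]
    by (simp only: square_sum add_ac)
  also have "\<dots> \<longleftrightarrow> x = y \<or> x = y + 1"
    unfolding square_eq_self using sum_eq_0_iff[of x "y + 1"] sum_eq_0_iff[of "x + y" 1]
    by (simp add: add.assoc)
  finally show ?thesis .
qed

lemma AS_add: "x \<in> AS \<Longrightarrow> y \<in> AS \<Longrightarrow> x + y \<in> (AS :: 'a set)"
proof (elim AS_E)
  fix u v assume "x = u^2 + u" "y = v^2 + v"
  hence "x + y = (u + v)^2 + (u + v)" by (simp add: square_sum algebra_simps)
  thus "x + y \<in> AS" by (simp only: AS_I)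
qed

lemma card_le_double_AS: "CARD('a) \<le> 2 * card (AS :: 'a set)"
proof -
  \<comment> \<open>\<open>r\<close> picks one preimage of each element of \<open>AS\<close>; by
    \<open>AS_fibre\<close> the other one is obtained by adding 1.\<close>
  define r where "r = inv_into UNIV (\<lambda>x::'a. x^2 + x)"
  have "(UNIV::'a set) \<subseteq> r ` AS \<union> (\<lambda>s. r s + 1) ` AS"
  proof
    fix x :: 'a
    define s where "s = x^2 + x"
    have s: "s \<in> AS" unfolding s_def ..
    have "(r s)^2 + r s = s" unfolding r_def using s[unfolded AS_def] by (rule f_inv_into_f)
    hence "x = r s \<or> x = r s + 1" using AS_fibre[of x "r s"] s_def by simp
    thus "x \<in> r ` AS \<union> (\<lambda>s. r s + 1) ` AS" using s by blast
  qed
  hence "CARD('a) \<le> card (r ` AS \<union> (\<lambda>s. r s + 1) ` AS)" by (intro card_mono) auto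
  also have "\<dots> \<le> card (r ` AS) + card ((\<lambda>s. r s + 1) ` AS)" by (rule card_Un_le)
  also have "\<dots> \<le> card (AS :: 'a set) + card (AS :: 'a set)" by (intro add_mono card_image_le) auto
  finally show ?thesis by simp
qed

text \<open>\<open>AS\<close> and its coset by \<open>x\<close> are disjoint and each contains at
  least half of the field, so they cover it and \<open>y\<close> lies in the coset.\<close>

lemma AS_index_2:
  assumes "x \<notin> AS" "y \<notin> AS"
  shows "x + y \<in> (AS :: 'a set)"
proof -
  have dis: "AS \<inter> (\<lambda>s. x + s) ` AS = {}"
  proof (rule ccontr)
    assume "\<not> ?thesis"
    then obtain s where "s \<in> AS" "x + s \<in> AS" by auto
    hence "(x + s) + s \<in> AS" by (metis AS_add)
    thus False using assms by (simp add: add.assoc)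
  qed
  have "card (AS \<union> (\<lambda>s. x + s) ` AS) = 2 * card (AS :: 'a set)"
  proof -
    have "card ((\<lambda>s. x + s) ` AS) = card (AS :: 'a set)" by (rule card_image) simp
    thus ?thesis by (subst card_Un_disjoint[OF _ _ dis]) (simp_all)
  qed
  hence "AS \<union> (\<lambda>s. x + s) ` AS = UNIV"
    using card_le_double_AS by (intro card_seteq) (simp_all)
  then obtain s where "s \<in> AS" "y = x + s" using assms by (metis UNIV_I UnE imageE)
  thus ?thesis by simp
qed

lemma ex_not_AS: "\<exists>x::'a. x \<notin> AS"
proof -
  have "\<not> inj (\<lambda>x::'a. x^2 + x)"
  proof
    assume "inj (\<lambda>x::'a. x^2 + x)"
    from injD[OF this, of 0 1] show False by simp
  qed
  hence "\<not> surj (\<lambda>x::'a. x^2 + x)" using finite_UNIV_surj_inj[of "\<lambda>x::'a. x^2 + x"] by auto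
  thus ?thesis unfolding AS_def by blast
qed

text \<open>The elements \<open>x\<close> and \<open>x^2\<close> differ by an element of the
  subgroup.\<close>

lemma AS_square: "x^2 \<in> AS \<longleftrightarrow> x \<in> (AS :: 'a set)"
proof -
  have 1: "x^2 + x \<in> AS" ..
  have "x^2 + (x^2 + x) = x" "x + (x^2 + x) = x^2" by (simp_all add: add.left_commute)
  thus ?thesis using AS_add[OF _ 1, of x] AS_add[OF _ 1, of "x^2"] by auto
qed

text \<open>Each line through the rational point \<open>(1,0)\<close>, parametrised by its slope, meets the conic
  in one point besides it; here \<open>x = y * z\<close> and \<open>y\<close> is the inverse square root
  of \<open>z\<^sup>2 + z + k\<close>.\<close>

lemma card_norm_one:
  assumes k: "k \<notin> (AS :: 'a set)"
  shows "card {(x,y). x^2 + x * y + k * y^2 = (1::'a)} = CARD('a) + 1"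
proof -
  have nz: "z^2 + z + k \<noteq> 0" for z
    using k AS_I[of z] by (metis sum_eq_0_iff)
  define y where "y z = (SOME r. r^2 = inverse (z^2 + z + k))" for z
  have y: "(y z)^2 = inverse (z^2 + z + k)" for z
    unfolding y_def by (rule someI_ex) (rule square_surj)
  have y0: "y z \<noteq> 0" for z using y[of z] nz[of z] by auto
  let ?f = "\<lambda>z. (y z * z, y z)"
  have "{(x,y). x^2 + x * y + k * y^2 = (1::'a)} = insert (1,0) (range ?f)" (is "?L = ?R")
  proof (intro equalityI subsetI)
    fix p assume "p \<in> ?L"
    then obtain a b where p: "p = (a,b)" "a^2 + a * b + k * b^2 = 1" by auto
    show "p \<in> ?R"
    proof (cases "b = 0")
      case True thus ?thesis using p square_inj[of a 1] by simp
    next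
      case False
      define z where "z = a / b"
      have a: "a = b * z" using False by (simp add: z_def)
      have "b^2 * (z^2 + z + k) = 1"
        using p(2) unfolding a by (simp add: algebra_simps power2_eq_square)
      hence "b^2 = (y z)^2" unfolding y using nz[of z] by (simp add: field_simps)
      hence "b = y z" by (rule square_inj)
      thus ?thesis using p a by blast
    qed
  next
    fix p assume "p \<in> ?R"
    moreover have "(y z * z)^2 + (y z * z) * y z + k * (y z)^2 = 1" for z
    proof -
      have "(y z * z)^2 + (y z * z) * y z + k * (y z)^2 = (y z)^2 * (z^2 + z + k)"
        by (simp add: algebra_simps power2_eq_square)
      thus ?thesis unfolding y using nz[of z] by simp
    qed
    ultimately show "p \<in> ?L" by auto
  qed
  moreover have "inj ?f" using y0 by (auto intro!: injI)
  moreover have "(1,0) \<notin> range ?f" using y0 by auto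
  ultimately show ?thesis by (simp add: card_image)
qed

end

section \<open>Elliptic quadratic forms on a four-dimensional space\<close>

text \<open>The form is a parameter so that every result can be reused for the forms induced on the
  various hyperplanes. Dimension four is encoded by a cardinality, which lets counting replace
  arguments with bases.\<close>

locale quadratic_space = char2_field "TYPE('a::{field,finite})" + vector_space scale
  for scale :: "'a::{field,finite} \<Rightarrow> 'v::{ab_group_add,finite} \<Rightarrow> 'v" (infixr \<open>\<cdot>\<close> 75) +
  fixes Q :: "'v \<Rightarrow> 'a" and B :: "'v \<Rightarrow> 'v \<Rightarrow> 'a"
  assumes Q_add: "Q (x + y) = Q x + Q y + B x y"
    and Q_scale: "Q (c \<cdot> x) = c^2 * Q x"
    and B_add_left: "B (x + y) z = B x z + B y z"
    and B_scale_left: "B (c \<cdot> x) z = c * B x z"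
    and B_nondeg: "x \<noteq> 0 \<Longrightarrow> \<exists>y. B x y \<noteq> 0"
    and card_space: "CARD('v) = CARD('a) ^ 4"
begin

lemma vec_add_self [simp]: "x + x = (0::'v)"
  using scale_left_distrib[of 1 1 x] by (simp del: scale_left_distrib add: char2)

lemma vec_add_self_left [simp]: "x + (x + y) = (y::'v)"
  by (simp add: add.assoc [symmetric])

lemma vec_sum_eq_0_iff [simp]: "x + y = 0 \<longleftrightarrow> x = (y::'v)"
  by (metis vec_add_self vec_add_self_left add.right_neutral)

lemma B_sym: "B x y = B y x"
proof -
  have "Q x + Q y + B x y = Q x + Q y + B y x"
    using Q_add[of x y] Q_add[of y x] by (simp only: add_ac)
  thus ?thesis by (simp only: add_left_cancel)
qed

lemma B_add_right: "B z (x + y) = B z x + B z y"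
  using B_add_left B_sym by metis

lemma B_scale_right: "B z (c \<cdot> x) = c * B z x"
  using B_scale_left B_sym by metis

lemmas B_lin = B_add_left B_add_right B_scale_left B_scale_right

lemma Q_zero [simp]: "Q 0 = 0"
  using Q_scale[of 0 0] by simp

lemma B_zero [simp]: "B 0 x = 0" "B x 0 = 0"
  using B_scale_left[of 0 0 x] B_scale_right[of x 0 0] by simp_all

lemma B_self [simp]: "B x x = 0"
  using Q_add[of x x] by simp

lemma ex_B_eq_1: "x \<noteq> 0 \<Longrightarrow> \<exists>y. B x y = 1"
proof -
  assume "x \<noteq> 0"
  then obtain y where "B x y \<noteq> 0" using B_nondeg by blast
  hence "B x (inverse (B x y) \<cdot> y) = 1" by (simp add: B_lin)
  thus ?thesis ..
qed

lemma card_field_gt_1: "CARD('a) > 1"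
  using card_mono[of UNIV "{0::'a,1}"] by simp

text \<open>The products with the four vectors recover the coefficients of a linear combination. So
  the combinations are distinct, and by \<open>card_space\<close> they exhaust the space.\<close>

lemma expand_hyperbolic_basis:
  assumes "B d e = 1" "B w u = 1" "B d w = 0" "B e w = 0" "B d u = 0" "B e u = 0"
  shows "x = B x e \<cdot> d + B x d \<cdot> e + B x u \<cdot> w + B x w \<cdot> u"
proof -
  let ?f = "\<lambda>(p,q,r,s). p \<cdot> d + q \<cdot> e + r \<cdot> w + s \<cdot> u"
  have sym: "B e d = 1" "B u w = 1" "B w d = 0" "B w e = 0" "B u d = 0" "B u e = 0"
    using assms B_sym by metis+
  have co: "B (p \<cdot> d + q \<cdot> e + r \<cdot> w + s \<cdot> u) e = p"
    "B (p \<cdot> d + q \<cdot> e + r \<cdot> w + s \<cdot> u) d = q"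
    "B (p \<cdot> d + q \<cdot> e + r \<cdot> w + s \<cdot> u) u = r"
    "B (p \<cdot> d + q \<cdot> e + r \<cdot> w + s \<cdot> u) w = s" for p q r s
    using assms sym by (simp_all add: B_lin)
  have inj: "inj ?f"
  proof (rule injI)
    fix a b assume eq: "?f a = ?f b"
    obtain p q r s p' q' r' s' where ab: "a = (p,q,r,s)" "b = (p',q',r',s')"
      by (metis surj_pair)
    show "a = b" using eq co[of p q r s] co[of p' q' r' s'] unfolding ab by auto
  qed
  have "range ?f = UNIV"
    by (rule card_seteq) (simp_all add: card_image[OF inj] card_space power4_eq_xxxx mult.assoc)
  hence "x \<in> range ?f" by simp
  then obtain p q r s where x: "x = p \<cdot> d + q \<cdot> e + r \<cdot> w + s \<cdot> u" by auto
  have "B x e = p" "B x d = q" "B x u = r" "B x w = s" unfolding x by (rule co)+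
  thus ?thesis using x by simp
qed

text \<open>This is the orthogonal projection away from the hyperbolic plane of \<open>d\<close> and
  \<open>e\<close>; signs disappear in characteristic two.\<close>

lemma proj_orthogonal:
  assumes "B d e = 1"
  shows "B d (x + B x e \<cdot> d + B x d \<cdot> e) = 0" "B e (x + B x e \<cdot> d + B x d \<cdot> e) = 0"
  using assms B_sym[of d e] B_sym[of x d] B_sym[of x e] by (simp_all add: B_lin)

text \<open>Otherwise each vector would be determined by its products with \<open>d\<close> and
  \<open>e\<close>, leaving at most \<open>q^2\<close> vectors.\<close>

lemma ex_orthogonal:
  assumes "B d e = 1"
  obtains w where "w \<noteq> 0" "B d w = 0" "B e w = 0"
proof -
  have "\<exists>x. x + B x e \<cdot> d + B x d \<cdot> e \<noteq> 0"
  proof (rule ccontr)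
    assume "\<not> ?thesis"
    hence eq: "x = B x e \<cdot> d + B x d \<cdot> e" for x by (metis add.assoc vec_sum_eq_0_iff)
    have "inj (\<lambda>x. (B x e, B x d))" by (rule injI) (metis eq prod.inject)
    hence "CARD('v) \<le> CARD('a \<times> 'a)" by (rule card_inj_on_le[of _ UNIV UNIV]) simp_all
    hence "CARD('a) ^ 4 \<le> CARD('a) ^ 2" by (simp add: card_space power2_eq_square)
    thus False using card_field_gt_1 by simp
  qed
  thus ?thesis using that proj_orthogonal[OF assms] by blast
qed

lemma ex_orthogonal_partner:
  assumes "B d e = 1" "w \<noteq> 0" "B d w = 0" "B e w = 0"
  obtains u where "B w u = 1" "B d u = 0" "B e u = 0"
proof -
  obtain u where u: "B w u = 1" using ex_B_eq_1 assms by blast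
  have "B w (u + B u e \<cdot> d + B u d \<cdot> e) = 1"
    using u assms B_sym[of w d] B_sym[of w e] by (simp add: B_lin)
  thus ?thesis using that proj_orthogonal[OF assms(1)] by blast
qed

section \<open>Elliptic forms: singular vectors, hyperplane sections, common partners\<close>

definition elliptic :: bool where
  "elliptic \<longleftrightarrow> (\<forall>x y. Q x = 0 \<longrightarrow> Q y = 0 \<longrightarrow> B x y = 0 \<longrightarrow> x \<noteq> 0 \<longrightarrow> (\<exists>c. y = c \<cdot> x))"

lemma ellipticD: "elliptic \<Longrightarrow> Q x = 0 \<Longrightarrow> Q y = 0 \<Longrightarrow> B x y = 0 \<Longrightarrow> x \<noteq> 0 \<Longrightarrow> \<exists>c. y = c \<cdot> x"
  unfolding elliptic_def by blast

text \<open>A singular vector orthogonal to \<open>d\<close> is a multiple of \<open>d\<close>, and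
  its product with \<open>e\<close> is then the factor.\<close>

lemma elliptic_anisotropic:
  assumes "elliptic" "Q d = 0" "B d e = 1" "B d x = 0" "B e x = 0" "Q x = 0"
  shows "x = 0"
proof -
  have "d \<noteq> 0" using assms(3) by auto
  then obtain c where x: "x = c \<cdot> d" using ellipticD assms by metis
  hence "c = 0" using assms(3,5) B_sym[of d e] by (simp add: B_lin)
  thus ?thesis using x by simp
qed

lemma ex_singular: "\<exists>x. x \<noteq> 0 \<and> Q x = 0"
proof -
  have "\<exists>x::'v. x \<noteq> 0"
  proof (rule ccontr)
    assume "\<not> ?thesis"
    hence "(UNIV::'v set) = {0}" by auto
    hence "CARD('v) = 1" by (metis card.empty card.insert empty_iff finite.emptyI One_nat_def)
    thus False using card_space card_field_gt_1 by simp
  qed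
  then obtain x :: 'v where x: "x \<noteq> 0" by blast
  then obtain e where e: "B x e = 1" using ex_B_eq_1 by blast
  obtain w where w: "w \<noteq> 0" "B x w = 0" "B e w = 0" using ex_orthogonal[OF e] .
  obtain s where s: "s^2 = Q w" using square_surj by blast
  obtain t where t: "t^2 = Q x" using square_surj by blast
  \<comment> \<open>As \<open>x\<close> and \<open>w\<close> are orthogonal, the norm of this vector
    is \<open>Q w * Q x\<close> added to itself. If \<open>s = 0\<close>, then \<open>w\<close>
    itself is singular.\<close>
  let ?z = "s \<cdot> x + t \<cdot> w"
  have "Q ?z = 0" using w by (simp add: Q_add Q_scale B_lin s t mult.commute)
  moreover have "B ?z e = s" using e w B_sym[of e w] by (simp add: B_lin)
  ultimately show ?thesis using w s by (cases "s = 0") (simp, metis, metis B_zero(1))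
qed

text \<open>The singular vectors do not lie in a hyperplane. This is what makes an ovoid determine
  its solid.\<close>

lemma singular_not_perp:
  assumes "d \<noteq> 0"
  shows "\<exists>x. x \<noteq> 0 \<and> Q x = 0 \<and> B d x \<noteq> 0"
proof -
  obtain x where x: "x \<noteq> 0" "Q x = 0" using ex_singular by blast
  show ?thesis
  proof (cases "B d x = 0")
    case False thus ?thesis using x by blast
  next
    case True
    obtain y1 y2 where "B d y1 \<noteq> 0" "B x y2 \<noteq> 0" using B_nondeg x assms by metis
    \<comment> \<open>A space is not the union of two hyperplanes: one of \<open>y1\<close>,
      \<open>y2\<close>, \<open>y1 + y2\<close> works.\<close>
    hence "\<exists>y. B d y \<noteq> 0 \<and> B x y \<noteq> 0"
      by (metis B_add_right add.left_neutral add.right_neutral)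
    then obtain y where y: "B d y \<noteq> 0" "B x y \<noteq> 0" by blast
    \<comment> \<open>The line joining the singular point \<open>x\<close> to \<open>y\<close> meets
      the quadric again at \<open>z\<close>, or is tangent-free at \<open>y\<close> itself when
      \<open>Q y = 0\<close>.\<close>
    define z where "z = B x y \<cdot> y + Q y \<cdot> x"
    have "Q z = 0" using x B_sym[of y x]
      by (simp add: z_def Q_add Q_scale B_lin power2_eq_square algebra_simps)
    moreover have "B d z \<noteq> 0" using True y by (simp add: z_def B_lin)
    ultimately show ?thesis by (metis B_zero(2))
  qed
qed

lemma tangent_section:
  assumes "elliptic" "d \<noteq> 0" "Q d = 0"
  shows "{x. x \<noteq> 0 \<and> Q x = 0 \<and> B d x = 0} = {c \<cdot> d | c. c \<noteq> 0}"
proof (intro equalityI subsetI)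
  fix x assume x: "x \<in> {x. x \<noteq> 0 \<and> Q x = 0 \<and> B d x = 0}"
  then obtain c where "x = c \<cdot> d" using ellipticD[of d x] assms by auto
  thus "x \<in> {c \<cdot> d | c. c \<noteq> 0}" using x by auto
qed (use assms in \<open>auto simp: Q_scale B_lin\<close>)

text \<open>Since \<open>d\<close> is nonsingular and orthogonal to itself, adding a multiple of
  \<open>d\<close> makes any vector orthogonal to \<open>d\<close> singular. Doing so to
  \<open>w\<close> and \<open>u\<close> keeps their product 1, hence their independence.\<close>

lemma secant_section:
  assumes "Q d \<noteq> 0"
  obtains x y where "x \<noteq> 0" "y \<noteq> 0" "Q x = 0" "Q y = 0" "B d x = 0" "B d y = 0" "\<nexists>c. y = c \<cdot> x"
proof -
  have "d \<noteq> 0" using assms by auto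
  then obtain e where e: "B d e = 1" using ex_B_eq_1 by blast
  obtain w where w: "w \<noteq> 0" "B d w = 0" "B e w = 0" using ex_orthogonal[OF e] .
  obtain u where u: "B w u = 1" "B d u = 0" "B e u = 0" using ex_orthogonal_partner[OF e w] .
  obtain r where r: "r^2 = Q w / Q d" using square_surj by blast
  obtain s where s: "s^2 = Q u / Q d" using square_surj by blast
  let ?x = "w + r \<cdot> d" and ?y = "u + s \<cdot> d"
  have sym: "B w d = 0" "B u d = 0" "B u w = 1" using w u B_sym by metis+
  have xy: "B ?x ?y = 1" using w u sym by (simp add: B_lin)
  have "\<nexists>c. ?y = c \<cdot> ?x" using xy by (metis B_scale_right B_self mult_zero_right zero_neq_one)
  moreover have "?x \<noteq> 0" "?y \<noteq> 0" using xy by (metis B_zero zero_neq_one)+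
  moreover have "Q ?x = 0" "Q ?y = 0" using sym assms by (simp_all add: Q_add Q_scale B_lin r s)
  moreover have "B d ?x = 0" "B d ?y = 0" using w u by (simp_all add: B_lin)
  ultimately show ?thesis using that by blast
qed

text \<open>If \<open>Q u = z^2 + z\<close>, then \<open>u + z w\<close> would be a nonzero singular
  vector in the anisotropic plane orthogonal to \<open>d\<close> and \<open>e\<close>.\<close>

lemma norm_not_AS:
  assumes "elliptic" "Q d = 0" "B d e = 1"
    and "B d w = 0" "B e w = 0" "Q w = 1" "B w u = 1" "B d u = 0" "B e u = 0"
  shows "Q u \<notin> AS"
proof
  assume "Q u \<in> AS"
  then obtain z where z: "Q u = z^2 + z" by (rule AS_E)
  have "B u w = 1" using assms B_sym by metis
  hence "Q (u + z \<cdot> w) = 0" using assms by (simp add: Q_add Q_scale B_lin z)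
  moreover have "B d (u + z \<cdot> w) = 0" "B e (u + z \<cdot> w) = 0" using assms by (simp_all add: B_lin)
  ultimately have "u + z \<cdot> w = 0" using elliptic_anisotropic assms(1-3) by metis
  moreover have "B w (u + z \<cdot> w) = 1" using assms by (simp add: B_lin)
  ultimately show False by simp
qed

text \<open>In the basis \<open>d, e, w, u\<close> the two products fix the first two coordinates at
  1, and singularity says that the other two lie on the conic of
  \<open>card_norm_one\<close>.\<close>

lemma card_common_partners_2:
  assumes ell: "elliptic" and d: "Q d = 0" and e: "Q e = 0" and de: "B d e = 1"
  shows "card {f. Q f = 0 \<and> B d f = 1 \<and> B e f = 1} = CARD('a) + 1"
proof -
  obtain w0 where w0: "w0 \<noteq> 0" "B d w0 = 0" "B e w0 = 0" using ex_orthogonal[OF de] .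
  have "Q w0 \<noteq> 0" using elliptic_anisotropic[OF ell d de] w0 by blast
  obtain s where s: "s^2 = Q w0" using square_surj by blast
  define w where "w = inverse s \<cdot> w0"
  have w: "w \<noteq> 0" "B d w = 0" "B e w = 0" "Q w = 1"
    using w0 \<open>Q w0 \<noteq> 0\<close> s by (auto simp: w_def B_lin Q_scale power_inverse)
  obtain u where u: "B w u = 1" "B d u = 0" "B e u = 0" using ex_orthogonal_partner[OF de w(1-3)] .
  have nAS: "Q u \<notin> AS" using norm_not_AS[OF ell d de w(2-4) u] .
  have sym: "B u w = 1" "B w d = 0" "B w e = 0" "B u d = 0" "B u e = 0" "B e d = 1"
    using w u de B_sym by metis+
  let ?f = "\<lambda>(r,t). d + e + r \<cdot> w + t \<cdot> u"
  let ?N = "{(x,y). x^2 + x * y + Q u * y^2 = (1::'a)}"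
  have QF: "Q (d + e + r \<cdot> w + t \<cdot> u) = 1 + (r^2 + r * t + Q u * t^2)" for r t
    using d e de w u by (simp add: Q_add Q_scale B_lin algebra_simps)
  have "{f. Q f = 0 \<and> B d f = 1 \<and> B e f = 1} = ?f ` ?N" (is "?L = ?R")
  proof (intro equalityI subsetI)
    fix f assume f: "f \<in> ?L"
    hence "B f d = 1" "B f e = 1" using B_sym by auto
    hence ff: "f = d + e + B f u \<cdot> w + B f w \<cdot> u"
      using expand_hyperbolic_basis[OF de u(1) w(2,3) u(2,3), of f] by simp
    have "Q f = 0" using f by simp
    hence "1 + ((B f u)^2 + B f u * B f w + Q u * (B f w)^2) = 0" using ff QF by metis
    hence "(B f u, B f w) \<in> ?N" by simp
    thus "f \<in> ?R" using ff by (metis (mono_tags, lifting) case_prod_conv imageI)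
  next
    fix f assume "f \<in> ?R"
    then obtain r t where "f = d + e + r \<cdot> w + t \<cdot> u" "r^2 + r * t + Q u * t^2 = 1" by auto
    thus "f \<in> ?L" using QF[of r t] de sym w u by (simp add: B_lin)
  qed
  moreover have "inj_on ?f ?N"
  proof (rule inj_onI)
    fix a b assume eq: "?f a = ?f b"
    obtain p q r s where ab: "a = (p,q)" "b = (r,s)" by (metis surj_pair)
    have "p = r" "q = s"
      using arg_cong[OF eq, of "B w"] arg_cong[OF eq, of "B u"] w u sym by (simp_all add: ab B_lin)
    thus "a = b" using ab by simp
  qed
  ultimately show ?thesis using card_norm_one[OF nAS] by (simp add: card_image)
qed

text \<open>A partner \<open>g\<close> has product \<open>1 + 1 + 1 = 1\<close> with
  \<open>w = d + e + f\<close>, so only its coordinate \<open>z\<close> along \<open>w\<close> is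
  free, subject to \<open>z^2 + z = 1 + Q u\<close>. The solutions \<open>z\<close> and
  \<open>z + 1\<close> give vectors that differ by \<open>w\<close>, whence their product is
  1.\<close>

lemma common_partners_3:
  assumes ell: "elliptic" and d: "Q d = 0" and e: "Q e = 0" and f: "Q f = 0"
    and de: "B d e = 1" and df: "B d f = 1" and ef: "B e f = 1"
  shows "(1::'a) \<in> AS \<Longrightarrow> {g. Q g = 0 \<and> B d g = 1 \<and> B e g = 1 \<and> B f g = 1} = {}"
    and "(1::'a) \<notin> AS \<Longrightarrow> \<exists>g h. {g. Q g = 0 \<and> B d g = 1 \<and> B e g = 1 \<and> B f g = 1} = {g,h} \<and> B g h = 1"
proof -
  define w where "w = d + e + f"
  let ?G = "{g. Q g = 0 \<and> B d g = 1 \<and> B e g = 1 \<and> B f g = 1}"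
  have sym1: "B e d = 1" "B f d = 1" "B f e = 1" using de df ef B_sym by metis+
  have w: "B d w = 0" "B e w = 0" "Q w = 1"
    using d e f de df ef sym1 by (simp_all add: w_def B_lin Q_add add.assoc)
  have w0: "w \<noteq> 0" using w(3) by auto
  obtain u where u: "B w u = 1" "B d u = 0" "B e u = 0" using ex_orthogonal_partner[OF de w0 w(1,2)] .
  have nAS: "Q u \<notin> AS" using norm_not_AS[OF ell d de w u] .
  have sym: "B u w = 1" "B w d = 0" "B w e = 0" "B u d = 0" "B u e = 0"
    using w u B_sym by metis+
  have feq: "f = d + e + w" by (simp add: w_def add.assoc add.left_commute)
  let ?g = "\<lambda>z. d + e + z \<cdot> w + u"
  have QG: "Q (?g z) = 1 + (Q u + (z^2 + z))" for z
    using d e de w u sym by (simp add: Q_add Q_scale B_lin algebra_simps)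
  have BG: "B d (?g z) = 1" "B e (?g z) = 1" "B f (?g z) = 1" for z
    unfolding feq using de sym1 sym w u by (simp_all add: B_lin)
  have G: "g \<in> ?G \<longleftrightarrow> (\<exists>z. g = ?g z \<and> 1 + Q u = z^2 + z)" for g
  proof
    assume g: "g \<in> ?G"
    hence g1: "B g d = 1" "B g e = 1" "B g f = 1" using B_sym by auto
    hence "B g w = 1" by (simp add: w_def B_lin)
    hence gg: "g = ?g (B g u)"
      using expand_hyperbolic_basis[OF de u(1) w(1,2) u(2,3), of g] g1 by simp
    have "Q g = (1 + Q u) + ((B g u)^2 + B g u)" using QG[of "B g u"] gg by (simp only: add.assoc)
    hence "1 + Q u = (B g u)^2 + B g u" using g by simp
    thus "\<exists>z. g = ?g z \<and> 1 + Q u = z^2 + z" using gg by blast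
  next
    assume "\<exists>z. g = ?g z \<and> 1 + Q u = z^2 + z"
    then obtain z where z: "g = ?g z" "1 + Q u = z^2 + z" by blast
    have "Q g = (1 + Q u) + (z^2 + z)" unfolding z(1) QG by (simp only: add.assoc)
    hence "Q g = 0" unfolding z(2) by (rule trans) (rule add_self)
    thus "g \<in> ?G" using z(1) BG by simp
  qed
  {
    assume "(1::'a) \<in> AS"
    hence "1 + Q u \<notin> AS" using nAS AS_add[of 1 "1 + Q u"] by (metis add_self_left)
    thus "?G = {}" using G AS_I by fastforce
  next
    assume "(1::'a) \<notin> AS"
    hence "1 + Q u \<in> AS" using nAS AS_index_2 by blast
    then obtain z where z: "1 + Q u = z^2 + z" by (rule AS_E)
    have "?G = {?g z, ?g (z + 1)}"
    proof (rule set_eqI)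
      fix g
      have "g \<in> ?G \<longleftrightarrow> (\<exists>y. g = ?g y \<and> (y = z \<or> y = z + 1))"
        unfolding G z using AS_fibre[of _ z] by metis
      also have "\<dots> \<longleftrightarrow> g \<in> {?g z, ?g (z + 1)}" by auto
      finally show "g \<in> ?G \<longleftrightarrow> g \<in> {?g z, ?g (z + 1)}" .
    qed
    moreover have "B (?g z) (?g (z + 1)) = 1"
    proof -
      have "?g (z + 1) = ?g z + w" by (simp add: scale_left_distrib add_ac)
      hence "B (?g z) (?g (z + 1)) = B (?g z) w" by (simp only: B_add_right B_self add_0_left)
      thus ?thesis using sym w B_sym by (simp add: B_lin)
    qed
    ultimately show "\<exists>g h. ?G = {g,h} \<and> B g h = 1" by blast
  }
qed

end

section \<open>The forms induced on the hyperplanes\<close>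

context quadratic_space
begin

definition twist :: "'v \<Rightarrow> 'v \<Rightarrow> 'a" where
  "twist a x = Q x + (B a x)^2"

text \<open>Squaring is additive, so the added term has no polar form and all twists share
  \<open>B\<close>.\<close>

lemma quadratic_space_twist: "quadratic_space scale (twist a) B"
  by unfold_locales
    (simp_all add: twist_def Q_add Q_scale B_lin square_sum power_mult_distrib card_space
      B_nondeg algebra_simps)

definition vertex :: "'v \<Rightarrow> bool" where
  "vertex a \<longleftrightarrow> quadratic_space.elliptic scale (twist a) B"

lemma vertex_iff: "vertex a \<longleftrightarrow> (\<forall>x y. twist a x = 0 \<longrightarrow> twist a y = 0 \<longrightarrow> B x y = 0 \<longrightarrow> x \<noteq> 0
    \<longrightarrow> (\<exists>c. y = c \<cdot> x))"
  unfolding vertex_def quadratic_space.elliptic_def[OF quadratic_space_twist] ..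

lemma vertexD: "vertex a \<Longrightarrow> twist a x = 0 \<Longrightarrow> twist a y = 0 \<Longrightarrow> B x y = 0 \<Longrightarrow> x \<noteq> 0
    \<Longrightarrow> \<exists>c. y = c \<cdot> x"
  unfolding vertex_iff by blast

lemma twist_add_right: "twist a (x + y) = twist a x + twist a y + B x y"
  by (rule quadratic_space.Q_add[OF quadratic_space_twist])

lemma twist_scale: "twist a (c \<cdot> x) = c^2 * twist a x"
  by (rule quadratic_space.Q_scale[OF quadratic_space_twist])

lemma twist_zero [simp]: "twist a 0 = 0"
  by (simp add: twist_def)

lemma twist_add_left: "twist (a + d) x = twist a x + (B d x)^2"
  by (simp add: twist_def B_lin square_sum add.assoc)

text \<open>The transvection \<open>x \<mapsto> x + B d x \<cdot> d\<close> is an isometry from \<open>twist (a + d)\<close> to \<open>twist a\<close>.\<close>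

lemma vertex_add:
  assumes "vertex a" "twist a d = 0"
  shows "vertex (a + d)"
  unfolding vertex_iff
proof (intro allI impI)
  define T where "T x = x + B d x \<cdot> d" for x
  have T_T: "T (T x) = x" for x by (simp add: T_def B_lin add.assoc)
  have T_scale: "T (c \<cdot> x) = c \<cdot> T x" for c x
    by (simp add: T_def B_lin scale_right_distrib)
  have T_twist: "twist a (T x) = twist (a + d) x" for x
    using assms(2) B_sym[of x d]
    by (simp add: T_def twist_add_right twist_scale twist_add_left B_lin power2_eq_square)
  have T_B: "B (T x) (T y) = B x y" for x y
    using B_sym[of x d] by (simp add: T_def B_lin add.assoc mult.commute)
  fix x y assume "twist (a + d) x = 0" "twist (a + d) y = 0" "B x y = 0" "x \<noteq> 0"
  moreover have "T x \<noteq> 0" using T_T[of x] \<open>x \<noteq> 0\<close> by (auto simp: T_def)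
  ultimately obtain c where "T y = c \<cdot> T x"
    using vertexD[OF assms(1), of "T x" "T y"] T_twist T_B by auto
  hence "y = c \<cdot> x" using T_T T_scale by metis
  thus "\<exists>c. y = c \<cdot> x" ..
qed

text \<open>The value of the form reduces to \<open>b + b^2\<close> with \<open>b = B d e\<close>,
  which vanishes only for 0 and 1.\<close>

lemma tangent_neighbours_iff:
  assumes "twist a d = 0" "twist a e = 0"
  shows "twist (a + d) (d + e) = 0 \<longleftrightarrow> B d e = 0 \<or> B d e = 1"
proof -
  have "twist (a + d) (d + e) = B d e + (B d e)^2"
    using assms by (simp add: twist_add_left twist_add_right B_lin)
  thus ?thesis using square_eq_self[of "B d e"] by auto
qed

end

section \<open>Coordinates on the elliptic ovoids\<close>

text \<open>In characteristic two, the hyperplane \<open>X0 = B a (X1,X2,X3,X4)\<close> has normal vector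
  \<open>normal a\<close>, and \<open>lift a\<close> parametrises it.\<close>

locale ovoid_coordinates = quadratic_space scale Q B
  for scale :: "'a::{field,finite} \<Rightarrow> 'v::{ab_group_add,finite} \<Rightarrow> 'v" (infixr \<open>\<cdot>\<close> 75)
    and Q :: "'v \<Rightarrow> 'a" and B :: "'v \<Rightarrow> 'v \<Rightarrow> 'a" +
  fixes vec5 :: "'a \<Rightarrow> 'v \<Rightarrow> 'a^5" and normal :: "'v \<Rightarrow> 'a^5"
  assumes vec5_eq_iff [simp]: "vec5 s x = vec5 t y \<longleftrightarrow> s = t \<and> x = y"
    and vec5_surj: "\<exists>t x. v = vec5 t x"
    and smult_vec5: "smult c (vec5 t x) = vec5 (c * t) (c \<cdot> x)"
    and vadd_vec5: "vadd (vec5 s x) (vec5 t y) = vec5 (s + t) (x + y)"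
    and vec5_eq_0_iff: "vec5 t x = 0 \<longleftrightarrow> t = 0 \<and> x = 0"
    and Qform_vec5: "Qform (vec5 t x) = t^2 + Q x"
    and vec5_in_hyp_normal: "c \<noteq> 0 \<Longrightarrow> vec5 t x \<in> hyp (smult c (normal a)) \<longleftrightarrow> t = B a x"
    and normal_or_nucleus: "(\<exists>c a. c \<noteq> 0 \<and> v = smult c (normal a)) \<or> vec5 1 0 \<in> hyp v"
    and ex_vertex: "\<exists>a. vertex a"
begin

definition lift :: "'v \<Rightarrow> 'v \<Rightarrow> 'a^5" where
  "lift a x = vec5 (B a x) x"

lemma lift_scale: "smult c (lift a x) = lift a (c \<cdot> x)"
  by (simp add: lift_def smult_vec5 B_lin)

lemma lift_add: "vadd (lift a x) (lift a y) = lift a (x + y)"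
  by (simp add: lift_def vadd_vec5 B_lin)

lemma lift_eq_0_iff [simp]: "lift a x = 0 \<longleftrightarrow> x = 0"
  by (auto simp: lift_def vec5_eq_0_iff)

lemma lift_eq_iff: "lift a x = lift b y \<longleftrightarrow> x = y \<and> B a x = B b x"
  by (auto simp: lift_def)

lemma Qform_lift: "Qform (lift a x) = twist a x"
  by (simp add: lift_def Qform_vec5 twist_def add.commute)

lemma polar_lift: "polar (lift a x) (lift a y) = B x y"
  by (simp add: polar_def lift_add Qform_lift twist_add_right add_ac)

lemma hyp_normal: "c \<noteq> 0 \<Longrightarrow> hyp (smult c (normal a)) = range (lift a)"
proof -
  assume c: "c \<noteq> 0"
  have "v \<in> hyp (smult c (normal a)) \<longleftrightarrow> v \<in> range (lift a)" for v
    using vec5_surj[of v] vec5_in_hyp_normal[OF c] by (auto simp: lift_def)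
  thus ?thesis by blast
qed

text \<open>The polar form on the hyperplane is \<open>B\<close>, so nondegeneracy is automatic and
  only the absence of lines is left to compare.\<close>

lemma elliptic_solid_normal_iff:
  assumes "c \<noteq> 0"
  shows "elliptic_solid (smult c (normal a)) \<longleftrightarrow> vertex a"
proof -
  have nz: "smult c (normal a) \<noteq> 0"
  proof
    assume "smult c (normal a) = 0"
    hence "vec5 1 0 \<in> hyp (smult c (normal a))" by (simp add: hyp_def)
    thus False using vec5_in_hyp_normal[OF assms] by simp
  qed
  have rad: "\<forall>x\<in>range (lift a). (\<forall>y\<in>range (lift a). polar x y = 0) \<longrightarrow> x = 0"
    using B_nondeg by (auto simp: polar_lift)
  have "(\<exists>x y. x \<in> range (lift a) \<and> y \<in> range (lift a) \<and> x \<noteq> 0 \<and> (\<forall>c. y \<noteq> smult c x) \<and>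
      Qform x = 0 \<and> Qform y = 0 \<and> polar x y = 0) \<longleftrightarrow>
    (\<exists>x y. lift a x \<noteq> 0 \<and> (\<forall>c. lift a y \<noteq> smult c (lift a x)) \<and>
      Qform (lift a x) = 0 \<and> Qform (lift a y) = 0 \<and> polar (lift a x) (lift a y) = 0)"
    by blast
  also have "\<dots> \<longleftrightarrow> \<not> vertex a"
    unfolding vertex_iff by (simp add: polar_lift Qform_lift lift_scale lift_eq_iff) blast
  finally show ?thesis
    unfolding elliptic_solid_def hyp_normal[OF assms] using nz rad by blast
qed

lemma elliptic_solid_iff:
  "elliptic_solid v \<longleftrightarrow> (\<exists>c a. c \<noteq> 0 \<and> v = smult c (normal a) \<and> vertex a)"
proof
  assume v: "elliptic_solid v"
  \<comment> \<open>This point is the nucleus of the quadric: its polar form with every vector is 0,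
    so a solid through it is degenerate.\<close>
  have "vec5 1 0 \<notin> hyp v"
  proof
    assume "vec5 1 0 \<in> hyp v"
    moreover have "polar (vec5 1 0) y = 0" for y
      using vec5_surj[of y] by (auto simp: polar_def vadd_vec5 Qform_vec5 square_sum)
    ultimately have "vec5 1 0 = 0" using v unfolding elliptic_solid_def by blast
    thus False by (simp add: vec5_eq_0_iff)
  qed
  thus "\<exists>c a. c \<noteq> 0 \<and> v = smult c (normal a) \<and> vertex a"
    using normal_or_nucleus[of v] elliptic_solid_normal_iff v by blast
qed (use elliptic_solid_normal_iff in blast)

definition ov :: "'v \<Rightarrow> ('a^5) set set" where
  "ov a = {proj_pt (lift a x) | x. x \<noteq> 0 \<and> twist a x = 0}"

lemma ovoid_of_normal: "c \<noteq> 0 \<Longrightarrow> ovoid_of (smult c (normal a)) = ov a"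
  unfolding ovoid_of_def ov_def hyp_normal by (auto simp: Qform_lift)

lemma elliptic_ovoid_iff: "elliptic_ovoid X \<longleftrightarrow> (\<exists>a. vertex a \<and> X = ov a)"
  unfolding elliptic_ovoid_def elliptic_solid_iff using ovoid_of_normal
  by (metis zero_neq_one)

lemma proj_pt_lift_eq:
  assumes "x \<noteq> 0" "y \<noteq> 0"
  shows "proj_pt (lift a x) = proj_pt (lift b y) \<longleftrightarrow> (\<exists>c. y = c \<cdot> x) \<and> B a x = B b x"
proof
  assume "proj_pt (lift a x) = proj_pt (lift b y)"
  moreover have "lift b y \<in> proj_pt (lift b y)"
    unfolding proj_pt_def lift_scale by (rule CollectI, rule exI[of _ 1]) simp
  ultimately obtain c where "c \<noteq> 0" "lift b y = lift a (c \<cdot> x)"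
    unfolding proj_pt_def lift_scale by auto
  thus "(\<exists>c. y = c \<cdot> x) \<and> B a x = B b x" by (auto simp: lift_eq_iff B_lin)
next
  assume "(\<exists>c. y = c \<cdot> x) \<and> B a x = B b x"
  then obtain c where c: "y = c \<cdot> x" "B a x = B b x" by blast
  hence c0: "c \<noteq> 0" using assms by auto
  have y: "lift b y = lift a (c \<cdot> x)" using c by (simp add: lift_eq_iff B_lin)
  have "smult s (lift a x) = smult (s / c) (lift b y)" "smult s (lift b y) = smult (s * c) (lift a x)" for s
    unfolding y lift_scale using c0 by simp_all
  moreover have "s / c \<noteq> 0" "s * c \<noteq> 0" if "s \<noteq> 0" for s using c0 that by simp_all
  ultimately show "proj_pt (lift a x) = proj_pt (lift b y)"
    unfolding proj_pt_def by blast
qed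

text \<open>At a common point \<open>B a\<close> and \<open>B b\<close> agree, and then so do the
  two twists; the intersection is a hyperplane section of the first ovoid.\<close>

lemma ov_inter:
  "ov a \<inter> ov b = {proj_pt (lift a x) | x. x \<noteq> 0 \<and> twist a x = 0 \<and> B (a + b) x = 0}" (is "_ = ?R")
proof (intro equalityI subsetI)
  fix p assume "p \<in> ov a \<inter> ov b"
  then obtain x y where xy: "p = proj_pt (lift a x)" "x \<noteq> 0" "twist a x = 0"
    "p = proj_pt (lift b y)" "y \<noteq> 0" unfolding ov_def by auto
  hence "B a x = B b x" using proj_pt_lift_eq by metis
  thus "p \<in> ?R" using xy by (auto simp: B_lin)
next
  fix p assume "p \<in> ?R"
  then obtain x where x: "p = proj_pt (lift a x)" "x \<noteq> 0" "twist a x = 0" "B a x = B b x"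
    by (auto simp: B_lin)
  moreover have "lift a x = lift b x" "twist b x = twist a x"
    using x by (simp_all add: lift_eq_iff twist_def)
  ultimately have "p \<in> ov a" "p \<in> ov b" unfolding ov_def by force+
  thus "p \<in> ov a \<inter> ov b" by blast
qed

text \<open>For distinct \<open>a\<close> and \<open>b\<close>, a singular vector not orthogonal to
  \<open>a + b\<close> gives a point of only one of the ovoids.\<close>

lemma ov_inj: "ov a = ov b \<Longrightarrow> a = b"
proof (rule ccontr)
  assume eq: "ov a = ov b" and "a \<noteq> b"
  hence "a + b \<noteq> 0" by simp
  then obtain x where x: "x \<noteq> 0" "twist a x = 0" "B (a + b) x \<noteq> 0"
    using quadratic_space.singular_not_perp[OF quadratic_space_twist] by metis
  have "proj_pt (lift a x) \<in> ov a" using x unfolding ov_def by blast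
  hence "proj_pt (lift a x) \<in> ov b" using eq by simp
  then obtain y where "y \<noteq> 0" "proj_pt (lift a x) = proj_pt (lift b y)" unfolding ov_def by blast
  hence "B a x = B b x" using proj_pt_lift_eq x by blast
  thus False using x by (simp add: B_lin)
qed

lemma ov_eq_iff [simp]: "ov a = ov b \<longleftrightarrow> a = b"
  using ov_inj by blast

lemma ov_inter_tangent:
  assumes "vertex a" "d \<noteq> 0" "twist a d = 0"
  shows "ov a \<inter> ov (a + d) = {proj_pt (lift a d)}"
proof -
  have "{x. x \<noteq> 0 \<and> twist a x = 0 \<and> B d x = 0} = {c \<cdot> d | c. c \<noteq> 0}"
    by (rule quadratic_space.tangent_section[OF quadratic_space_twist]) (use assms vertex_def in auto)
  hence "ov a \<inter> ov (a + d) = {proj_pt (lift a (c \<cdot> d)) | c. c \<noteq> 0}"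
    unfolding ov_inter by (simp add: set_eq_iff) metis
  moreover have "proj_pt (lift a (c \<cdot> d)) = proj_pt (lift a d)" if "c \<noteq> 0" for c
  proof -
    have "c \<cdot> d \<noteq> 0" using that assms by simp
    thus ?thesis using proj_pt_lift_eq[of d "c \<cdot> d" a a] assms by auto
  qed
  hence "{proj_pt (lift a (c \<cdot> d)) | c. c \<noteq> 0} = {proj_pt (lift a d)}"
    by (auto intro!: exI[of _ 1])
  ultimately show ?thesis by simp
qed

lemma card_ov_inter_secant:
  assumes "twist a d \<noteq> 0"
  shows "card (ov a \<inter> ov (a + d)) \<noteq> 1"
proof
  assume "card (ov a \<inter> ov (a + d)) = 1"
  then obtain p where p: "ov a \<inter> ov (a + d) = {p}" by (rule card_1_singletonE)
  obtain x y where xy: "x \<noteq> 0" "y \<noteq> 0" "twist a x = 0" "twist a y = 0"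
    "B d x = 0" "B d y = 0" "\<nexists>c. y = c \<cdot> x"
    using quadratic_space.secant_section[OF quadratic_space_twist assms] by metis
  hence "proj_pt (lift a x) \<in> {p}" "proj_pt (lift a y) \<in> {p}"
    unfolding p[symmetric] ov_inter by auto
  hence "proj_pt (lift a x) = proj_pt (lift a y)" by simp
  thus False using proj_pt_lift_eq xy by blast
qed

lemma adjacent_ov_iff:
  "adjacent (ov a) (ov b) \<longleftrightarrow> vertex a \<and> vertex b \<and> a \<noteq> b \<and> twist a (a + b) = 0"
proof (cases "vertex a \<and> vertex b \<and> a \<noteq> b")
  case True
  \<comment> \<open>Writing \<open>b\<close> as \<open>a + (a + b)\<close> brings the pair into the
    shape of the tangent and secant cases.\<close>
  hence "card (ov a \<inter> ov (a + (a + b))) = 1 \<longleftrightarrow> twist a (a + b) = 0"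
    using ov_inter_tangent[of a "a + b"] card_ov_inter_secant[of a "a + b"]
    by (cases "twist a (a + b) = 0") (simp_all del: vec_add_self_left)
  thus ?thesis using True by (auto simp: adjacent_def elliptic_ovoid_iff)
qed (auto simp: adjacent_def elliptic_ovoid_iff)

end

section \<open>Cliques\<close>

lemma clique_subset: "clique C \<Longrightarrow> D \<subseteq> C \<Longrightarrow> clique D"
  unfolding clique_def by blast

lemma linear_clique_subset: "linear_clique C \<Longrightarrow> D \<subseteq> C \<Longrightarrow> linear_clique D"
  unfolding linear_clique_def using clique_subset by blast

lemma adjacent_sym: "adjacent X Y \<longleftrightarrow> adjacent Y X"
  unfolding adjacent_def by (auto simp: Int_commute)

lemma clique_insert:
  "clique (insert X C) \<longleftrightarrow> elliptic_ovoid X \<and> clique C \<and> (\<forall>Y\<in>C. Y \<noteq> X \<longrightarrow> adjacent X Y)"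
  unfolding clique_def using adjacent_sym by blast

lemma rosette_clique: "rosette p R \<Longrightarrow> clique R"
  unfolding rosette_def clique_def adjacent_def by simp

text \<open>A rosette is a clique, so a maximal clique inside one is the whole rosette.\<close>

lemma maximal_linear_clique_card:
  fixes C :: "('a::{field,finite}^5) set set set"
  assumes "maximal_clique C" "linear_clique C"
  shows "card C = CARD('a)"
proof -
  obtain p R where R: "rosette p R" "C \<subseteq> R" using assms(2) unfolding linear_clique_def by blast
  hence "R = C" using assms(1) rosette_clique unfolding maximal_clique_def by blast
  thus ?thesis using R unfolding rosette_def by simp
qed

definition extensions :: "('a::field^5) set set set \<Rightarrow> ('a^5) set set set" where
  "extensions C = {X. X \<notin> C \<and> clique (insert X C)}"

text \<open>Each larger clique is determined by its one additional vertex.\<close>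

lemma card_superclique:
  assumes "kclique k C"
  shows "card {D. kclique (Suc k) D \<and> C \<subseteq> D} = card (extensions C)"
proof -
  have fin: "finite C" "card C = k" using assms unfolding kclique_def by simp_all
  have "{D. kclique (Suc k) D \<and> C \<subseteq> D} = (\<lambda>X. insert X C) ` extensions C" (is "?L = ?R")
  proof (intro equalityI subsetI)
    fix D assume D: "D \<in> ?L"
    hence "finite D" "card D = Suc k" "C \<subseteq> D" "clique D" unfolding kclique_def by simp_all
    hence "card (D - C) = 1" using fin by (simp add: card_Diff_subset)
    then obtain X where "D - C = {X}" by (rule card_1_singletonE)
    hence "D = insert X C" "X \<notin> C" using \<open>C \<subseteq> D\<close> by blast+
    thus "D \<in> ?R" using \<open>clique D\<close> unfolding extensions_def by blast
  qed (use fin in \<open>auto simp: extensions_def kclique_def\<close>)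
  moreover have "inj_on (\<lambda>X. insert X C) (extensions C)"
    by (rule inj_onI) (auto simp: extensions_def)
  ultimately show ?thesis by (simp add: card_image)
qed

lemma clique_subset_extensions:
  assumes "clique C" "K \<subseteq> C"
  shows "C \<subseteq> K \<union> extensions K"
proof
  fix X assume "X \<in> C"
  hence "clique (insert X K)" using assms clique_subset by (metis insert_subset)
  thus "X \<in> K \<union> extensions K" unfolding extensions_def by blast
qed

section \<open>Stars, triangles and their extensions\<close>

context ovoid_coordinates
begin

lemma adjacent_star_iff:
  assumes "vertex a"
  shows "adjacent (ov a) Y \<longleftrightarrow> (\<exists>d. d \<noteq> 0 \<and> twist a d = 0 \<and> Y = ov (a + d))"
proof
  assume adj: "adjacent (ov a) Y"
  then obtain b where b: "Y = ov b" unfolding adjacent_def elliptic_ovoid_iff by blast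
  hence "a \<noteq> b" "twist a (a + b) = 0" using adj adjacent_ov_iff by blast+
  moreover have "b = a + (a + b)" by simp
  ultimately show "\<exists>d. d \<noteq> 0 \<and> twist a d = 0 \<and> Y = ov (a + d)" using b vec_sum_eq_0_iff by metis
next
  assume "\<exists>d. d \<noteq> 0 \<and> twist a d = 0 \<and> Y = ov (a + d)"
  then obtain d where d: "d \<noteq> 0" "twist a d = 0" "Y = ov (a + d)" by blast
  thus "adjacent (ov a) Y" using assms vertex_add by (simp add: adjacent_ov_iff)
qed

lemma adjacent_neighbours_iff:
  assumes "vertex a" "twist a d = 0" "twist a e = 0"
  shows "adjacent (ov (a + d)) (ov (a + e)) \<longleftrightarrow> d \<noteq> e \<and> (B d e = 0 \<or> B d e = 1)"
proof -
  have eq: "(a + d) + (a + e) = d + e" by (simp add: add.left_commute add.assoc)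
  thus ?thesis
    using assms vertex_add tangent_neighbours_iff[OF assms(2,3)] by (simp add: eq adjacent_ov_iff)
qed

text \<open>Any two of the vectors \<open>a + c d\<close> differ by a multiple of \<open>d\<close>,
  so the corresponding ovoids are all tangent at the point of \<open>d\<close>.\<close>

lemma rosette_pencil:
  assumes a: "vertex a" and d: "d \<noteq> 0" "twist a d = 0"
  shows "rosette (proj_pt (lift a d)) (range (\<lambda>c. ov (a + c \<cdot> d)))"
  unfolding rosette_def
proof (intro conjI ballI impI)
  have vert: "vertex (a + c \<cdot> d)" for c using a d by (simp add: vertex_add twist_scale)
  show "proj_pt (lift a d) \<in> Q0_points"
    unfolding Q0_points_def using d by (auto simp: Qform_lift intro!: exI[of _ "lift a d"])
  show "elliptic_ovoid X" if "X \<in> range (\<lambda>c. ov (a + c \<cdot> d))" for X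
    using that vert by (auto simp: elliptic_ovoid_iff)
  show "finite (range (\<lambda>c. ov (a + c \<cdot> d)))" by simp
  show "card (range (\<lambda>c. ov (a + c \<cdot> d))) = CARD('a)"
    by (rule card_image) (use d in \<open>auto intro!: injI\<close>)
  fix X Y assume "X \<in> range (\<lambda>c. ov (a + c \<cdot> d))" "Y \<in> range (\<lambda>c. ov (a + c \<cdot> d))" "X \<noteq> Y"
  then obtain r s where XY: "X = ov (a + r \<cdot> d)" "Y = ov (a + s \<cdot> d)" "r \<noteq> s" by auto
  define t where "t = r + s"
  have t0: "t \<noteq> 0" using XY by (simp add: t_def)
  have Y: "Y = ov ((a + r \<cdot> d) + t \<cdot> d)"
    by (simp add: XY t_def scale_left_distrib add.assoc)
  have "X \<inter> Y = {proj_pt (lift (a + r \<cdot> d) (t \<cdot> d))}"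
    unfolding Y XY(1) by (rule ov_inter_tangent) (use vert t0 d in \<open>auto simp: twist_scale twist_add_left B_lin\<close>)
  also have "proj_pt (lift (a + r \<cdot> d) (t \<cdot> d)) = proj_pt (lift a d)"
    using proj_pt_lift_eq[of d "t \<cdot> d" a "a + r \<cdot> d"] d t0 by (auto simp: B_lin)
  finally show "X \<inter> Y = {proj_pt (lift a d)}" .
qed

lemma linear_clique_pencil:
  assumes "vertex a" "d \<noteq> 0" "twist a d = 0" "clique C" "C \<subseteq> range (\<lambda>c. ov (a + c \<cdot> d))"
  shows "linear_clique C"
  unfolding linear_clique_def using assms rosette_pencil by blast

text \<open>Of the two products that allow adjacency, 1 is the one that prevents the three ovoids
  from lying in a rosette.\<close>

definition triangle :: "'v \<Rightarrow> 'v \<Rightarrow> 'v \<Rightarrow> bool" where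
  "triangle a d e \<longleftrightarrow> vertex a \<and> twist a d = 0 \<and> twist a e = 0 \<and> B d e = 1"

definition star :: "'v \<Rightarrow> 'v set \<Rightarrow> ('a^5) set set set" where
  "star a D = insert (ov a) ((\<lambda>d. ov (a + d)) ` D)"

lemma triangle_distinct: "triangle a d e \<Longrightarrow> d \<noteq> 0 \<and> e \<noteq> 0 \<and> d \<noteq> e"
  unfolding triangle_def by auto

text \<open>In a rosette both tangency points on the ovoid of \<open>a\<close> would coincide,
  making \<open>e\<close> a multiple of \<open>d\<close> and their product 0.\<close>

lemma triangle_not_linear:
  assumes "triangle a d e"
  shows "\<not> linear_clique (star a {d,e})"
proof
  assume "linear_clique (star a {d,e})"
  then obtain p R where R: "rosette p R" "star a {d,e} \<subseteq> R" unfolding linear_clique_def by blast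
  have t: "vertex a" "twist a d = 0" "twist a e = 0" "B d e = 1" "d \<noteq> 0" "e \<noteq> 0"
    using assms triangle_distinct[OF assms] unfolding triangle_def by auto
  have mem: "ov a \<in> R" "ov (a + d) \<in> R" "ov (a + e) \<in> R" using R unfolding star_def by auto
  have ne: "ov a \<noteq> ov (a + d)" "ov a \<noteq> ov (a + e)" using t by simp_all
  have "ov a \<inter> ov (a + d) = {p}" "ov a \<inter> ov (a + e) = {p}"
    using R(1) mem ne unfolding rosette_def by blast+
  hence "proj_pt (lift a d) = proj_pt (lift a e)" using ov_inter_tangent t by simp
  then obtain c where "e = c \<cdot> d" using proj_pt_lift_eq t by blast
  thus False using t by (simp add: B_lin)
qed

text \<open>A non-linear clique through \<open>ov a\<close> and \<open>ov (a + d)\<close> leaves the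
  pencil of \<open>d\<close>. A member \<open>ov (a + e)\<close> outside it cannot have
  \<open>B d e = 0\<close>, which would make \<open>e\<close> proportional to
  \<open>d\<close>.\<close>

lemma nonlinear_clique_contains_triangle:
  fixes C :: "('a^5) set set set"
  assumes C: "clique C" and nl: "\<not> linear_clique C"
  obtains a d e where "triangle a d e" "star a {d,e} \<subseteq> C"
proof -
  have "C \<noteq> {}"
  proof
    assume "C = {}"
    obtain a where a: "vertex a" using ex_vertex by blast
    obtain d where "d \<noteq> 0" "twist a d = 0"
      using quadratic_space.ex_singular[OF quadratic_space_twist, of a] by blast
    thus False using linear_clique_pencil[OF a _ _ C] \<open>C = {}\<close> nl by blast
  qed
  then obtain X0 where X0: "X0 \<in> C" by blast
  hence "elliptic_ovoid X0" using C unfolding clique_def by simp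
  then obtain a where a: "vertex a" "ov a \<in> C" using X0 unfolding elliptic_ovoid_iff by blast
  have nb: "\<exists>d. d \<noteq> 0 \<and> twist a d = 0 \<and> X = ov (a + d)" if "X \<in> C" "X \<noteq> ov a" for X
  proof -
    have "adjacent (ov a) X" using C a(2) that unfolding clique_def by simp
    thus ?thesis by (simp only: adjacent_star_iff[OF a(1)])
  qed
  \<comment> \<open>For a one-element clique any singular \<open>d\<close> serves, since its pencil
    contains \<open>ov a\<close>; that case is refuted as soon as a member outside the pencil
    appears.\<close>
  obtain d where d: "d \<noteq> 0" "twist a d = 0" "ov (a + d) \<in> C \<or> C = {ov a}"
  proof (cases "C = {ov a}")
    case True
    moreover obtain d where "d \<noteq> 0" "twist a d = 0"
      using quadratic_space.ex_singular[OF quadratic_space_twist, of a] by blast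
    ultimately show ?thesis by (intro that[of d]) simp_all
  next
    case False
    then obtain X where X: "X \<in> C" "X \<noteq> ov a" using a by blast
    then obtain d where "d \<noteq> 0" "twist a d = 0" "X = ov (a + d)" using nb[OF X] by blast
    thus ?thesis using X by (intro that[of d]) simp_all
  qed
  have "\<not> C \<subseteq> range (\<lambda>c. ov (a + c \<cdot> d))"
    using linear_clique_pencil[OF a(1) d(1,2) C] nl by blast
  then obtain X where X: "X \<in> C" "X \<notin> range (\<lambda>c. ov (a + c \<cdot> d))" by blast
  have "ov a = ov (a + 0 \<cdot> d)" "ov (a + d) = ov (a + 1 \<cdot> d)" by simp_all
  hence X': "X \<noteq> ov a" "X \<noteq> ov (a + d)" using X by (metis rangeI)+
  then obtain e where e: "e \<noteq> 0" "twist a e = 0" "X = ov (a + e)" using nb[OF X(1) X'(1)] by blast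
  have dC: "ov (a + d) \<in> C" using d X X' by blast
  have "adjacent (ov (a + d)) X" using C dC X(1) X'(2) unfolding clique_def by metis
  hence "B d e = 0 \<or> B d e = 1" using adjacent_neighbours_iff[OF a(1) d(2) e(2)] e(3) by simp
  moreover have "B d e \<noteq> 0"
  proof
    assume "B d e = 0"
    then obtain c where "e = c \<cdot> d" using vertexD[OF a(1) d(2) e(2) _ d(1)] by blast
    thus False using X(2) e(3) by blast
  qed
  ultimately have "triangle a d e" using a d e unfolding triangle_def by blast
  moreover have "star a {d,e} \<subseteq> C" using a(2) dC X(1) e(3) unfolding star_def by simp
  ultimately show ?thesis by (rule that)
qed

lemma card_star:
  assumes "0 \<notin> D"
  shows "card (star a D) = card D + 1"
proof -
  have "card ((\<lambda>d. ov (a + d)) ` D) = card D" by (rule card_image) (auto intro!: inj_onI)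
  moreover have "ov a \<notin> (\<lambda>d. ov (a + d)) ` D" using assms by auto
  ultimately show ?thesis unfolding star_def by simp
qed

text \<open>A vector proportional to \<open>d\<close> cannot extend a star containing \<open>d\<close> and another vector
  \<open>e\<close>: the product with \<open>e\<close> is the proportionality factor, which would have to be 0 or 1.\<close>

lemma extensions_star:
  assumes a: "vertex a" and sing: "\<And>d. d \<in> D \<Longrightarrow> twist a d = 0"
    and D1: "\<And>d e. d \<in> D \<Longrightarrow> e \<in> D \<Longrightarrow> d \<noteq> e \<Longrightarrow> B d e = 1"
    and D2: "\<And>d. d \<in> D \<Longrightarrow> \<exists>e\<in>D. e \<noteq> d"
    and ne: "D \<noteq> {}"
  shows "extensions (star a D) = (\<lambda>f. ov (a + f)) ` {f. twist a f = 0 \<and> (\<forall>d\<in>D. B d f = 1)}"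
    (is "?L = ?R")
proof (intro equalityI subsetI)
  have D0: "d \<noteq> 0" if "d \<in> D" for d using D1[of d] D2[OF that] that by force
  fix X assume "X \<in> ?L"
  hence X: "X \<notin> star a D" "clique (insert X (star a D))" unfolding extensions_def by auto
  have adj: "adjacent Y X" if "Y \<in> star a D" for Y
    using X that unfolding clique_def by (metis insertCI)
  have "ov a \<in> star a D" unfolding star_def by simp
  then obtain f where f: "f \<noteq> 0" "twist a f = 0" "X = ov (a + f)"
    using adj adjacent_star_iff[OF a] by metis
  have mem: "ov (a + d) \<in> star a D" if "d \<in> D" for d using that unfolding star_def by blast
  have 01: "d \<noteq> f \<and> (B d f = 0 \<or> B d f = 1)" if "d \<in> D" for d
    using adj[OF mem[OF that]] adjacent_neighbours_iff[OF a sing[OF that] f(2)] f(3) by blast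
  have "B d f = 1" if d: "d \<in> D" for d
  proof (rule ccontr)
    assume "B d f \<noteq> 1"
    hence "B d f = 0" using 01[OF d] by blast
    then obtain c where c: "f = c \<cdot> d" using vertexD[OF a sing[OF d] f(2)] D0[OF d] by blast
    obtain e where e: "e \<in> D" "e \<noteq> d" using D2[OF d] by blast
    have "B e f = c" unfolding c using D1[OF e(1) d] e by (simp add: B_lin)
    hence "c = 0 \<or> c = 1" using 01[OF e(1)] by blast
    thus False using c f(1) 01[OF d] by auto
  qed
  thus "X \<in> ?R" using f by blast
next
  have D0: "d \<noteq> 0" if "d \<in> D" for d using D1[of d] D2[OF that] that by force
  fix X assume "X \<in> ?R"
  then obtain f where f: "X = ov (a + f)" "twist a f = 0" "\<And>d. d \<in> D \<Longrightarrow> B d f = 1" by blast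
  have f0: "f \<noteq> 0" using ne f(3) by force
  have fd: "f \<noteq> d" if "d \<in> D" for d using f(3)[OF that] by auto
  have ell: "elliptic_ovoid (ov (a + d))" if "twist a d = 0" for d
    using vertex_add[OF a that] elliptic_ovoid_iff by blast
  have adj_a: "adjacent (ov a) (ov (a + d))" if "twist a d = 0" "d \<noteq> 0" for d
    using adjacent_star_iff[OF a] that by blast
  have adj: "adjacent (ov (a + d)) (ov (a + e))" if "d \<in> D" "e \<in> D" "d \<noteq> e" for d e
    using adjacent_neighbours_iff[OF a sing sing] D1 that by blast
  have adj_f: "adjacent (ov (a + d)) (ov (a + f))" if "d \<in> D" for d
    using adjacent_neighbours_iff[OF a sing f(2)] f(3) fd that by blast
  have "clique ((\<lambda>d. ov (a + d)) ` D)"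
    unfolding clique_def using ell sing adj by auto
  moreover have "elliptic_ovoid (ov a)" using a elliptic_ovoid_iff by blast
  ultimately have cl: "clique (star a D)"
    unfolding star_def clique_insert using adj_a sing D0 by simp
  have "\<forall>Y\<in>star a D. adjacent X Y"
    unfolding star_def f(1) using adj_a[OF f(2) f0] adj_f
    by (simp add: adjacent_sym[of "ov (a + f)"])
  hence "clique (insert X (star a D))"
    unfolding clique_insert using cl ell[OF f(2)] f(1) by simp
  moreover have "X \<notin> star a D" unfolding star_def f(1) using f0 fd by auto
  ultimately show "X \<in> ?L" unfolding extensions_def by blast
qed

lemma extensions_triangle:
  assumes "triangle a d e"
  shows "extensions (star a {d,e}) = (\<lambda>f. ov (a + f)) ` {f. twist a f = 0 \<and> B d f = 1 \<and> B e f = 1}"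
proof -
  have "d \<noteq> e" using triangle_distinct assms by blast
  thus ?thesis
    using extensions_star[of a "{d,e}"] assms B_sym[of d e] unfolding triangle_def by auto
qed

lemma card_extensions_triangle:
  assumes "triangle a d e"
  shows "card (extensions (star a {d,e})) = CARD('a) + 1"
proof -
  have "card {f. twist a f = 0 \<and> B d f = 1 \<and> B e f = 1} = CARD('a) + 1"
    by (rule quadratic_space.card_common_partners_2[OF quadratic_space_twist])
      (use assms in \<open>simp_all add: triangle_def vertex_def\<close>)
  thus ?thesis unfolding extensions_triangle[OF assms]
    by (subst card_image) (auto intro!: inj_onI)
qed

lemma card_star_triangle: "triangle a d e \<Longrightarrow> card (star a {d,e}) = 3"
  using triangle_distinct[of a d e] card_star[of "{d,e}" a] by auto

lemma nonlinear_3_clique: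
  fixes C :: "('a^5) set set set"
  assumes "kclique 3 C" "\<not> linear_clique C"
  obtains a d e where "triangle a d e" "C = star a {d,e}"
proof -
  obtain a d e where t: "triangle a d e" "star a {d,e} \<subseteq> C"
    using nonlinear_clique_contains_triangle assms unfolding kclique_def by metis
  have "star a {d,e} = C"
    by (rule card_subset_eq) (use t assms card_star_triangle in \<open>auto simp: kclique_def\<close>)
  thus ?thesis using that t by blast
qed

text \<open>Such a clique is a triangle with one extension, hence the star of three vectors with
  pairwise products 1, and \<open>common_partners_3\<close> lists what can be added.\<close>

lemma nonlinear_4_clique_extensions:
  fixes C :: "('a^5) set set set"
  assumes "kclique 4 C" "\<not> linear_clique C"
  shows "(1::'a) \<in> AS \<Longrightarrow> extensions C = {}"
    and "(1::'a) \<notin> AS \<Longrightarrow> \<exists>X Y. extensions C = {X,Y} \<and> adjacent X Y"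
proof -
  have C: "clique C" "card C = 4" "finite C" using assms(1) unfolding kclique_def by auto
  obtain a d e where t: "triangle a d e" and sub: "star a {d,e} \<subseteq> C"
    using nonlinear_clique_contains_triangle[OF C(1) assms(2)] .
  have "\<not> C \<subseteq> star a {d,e}"
    using card_star_triangle[OF t] C card_mono[of "star a {d,e}" C] by auto
  then obtain X where X: "X \<in> C" "X \<notin> star a {d,e}" by blast
  have "insert X (star a {d,e}) = C"
    by (rule card_subset_eq) (use C X sub card_star_triangle[OF t] in auto)
  moreover have "X \<in> extensions (star a {d,e})"
    using clique_subset_extensions[OF C(1) sub] X by blast
  then obtain f where f: "X = ov (a + f)" "twist a f = 0" "B d f = 1" "B e f = 1"
    unfolding extensions_triangle[OF t] by blast
  ultimately have C_eq: "C = star a {d,e,f}" unfolding star_def by auto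
  have t': "vertex a" "twist a d = 0" "twist a e = 0" "B d e = 1"
    using t unfolding triangle_def by auto
  have sym: "B e d = 1" "B f d = 1" "B f e = 1" using t' f B_sym by metis+
  have dist: "d \<noteq> e" "d \<noteq> f" "e \<noteq> f" using t' f by auto
  let ?G = "{g. twist a g = 0 \<and> B d g = 1 \<and> B e g = 1 \<and> B f g = 1}"
  have ext: "extensions C = (\<lambda>g. ov (a + g)) ` ?G"
    unfolding C_eq using extensions_star[of a "{d,e,f}"] t' f sym dist by auto
  note partners = quadratic_space.common_partners_3[OF quadratic_space_twist
      t'(1)[unfolded vertex_def] t'(2,3) f(2) t'(4) f(3,4)]
  {
    assume "(1::'a) \<in> AS"
    thus "extensions C = {}" using partners(1) ext by simp
  next
    assume "(1::'a) \<notin> AS"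
    then obtain g h where gh: "?G = {g,h}" "B g h = 1" using partners(2) by blast
    hence "g \<noteq> h" by auto
    have "twist a g = 0" "twist a h = 0" using gh(1) by blast+
    hence "adjacent (ov (a + g)) (ov (a + h))"
      using adjacent_neighbours_iff t'(1) gh(2) \<open>g \<noteq> h\<close> by blast
    thus "\<exists>X Y. extensions C = {X,Y} \<and> adjacent X Y" unfolding ext gh(1) by blast
  }
qed

text \<open>Either the clique is just the triangle that it contains, or a further member completes
  this triangle to a 4-clique, which inherits non-linearity.\<close>

lemma nonlinear_clique_cases:
  fixes C :: "('a^5) set set set"
  assumes "clique C" "\<not> linear_clique C"
  obtains (three) "kclique 3 C"
  | (four) K where "kclique 4 K" "\<not> linear_clique K" "K \<subseteq> C"
proof -
  obtain a d e where t: "triangle a d e" and sub: "star a {d,e} \<subseteq> C"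
    using nonlinear_clique_contains_triangle[OF assms] .
  show ?thesis
  proof (cases "C = star a {d,e}")
    case True
    thus ?thesis using three assms card_star_triangle[OF t] by (simp add: kclique_def)
  next
    case False
    then obtain X where X: "X \<in> C" "X \<notin> star a {d,e}" using sub by blast
    show ?thesis
    proof (rule four)
      show "insert X (star a {d,e}) \<subseteq> C" using X sub by simp
      thus "kclique 4 (insert X (star a {d,e}))"
        using X card_star_triangle[OF t] clique_subset[OF assms(1)] by (simp add: kclique_def)
      show "\<not> linear_clique (insert X (star a {d,e}))"
        using triangle_not_linear[OF t] linear_clique_subset by blast
    qed
  qed
qed

section \<open>Numbers of extensions and sizes of maximal cliques\<close>

lemma card_nonlinear_extensions_3:
  fixes C :: "('a^5) set set set"
  assumes "kclique 3 C" "\<not> linear_clique C"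
  shows "card {D. kclique 4 D \<and> \<not> linear_clique D \<and> C \<subseteq> D} = CARD('a) + 1"
proof -
  obtain a d e where t: "triangle a d e" "C = star a {d,e}" using nonlinear_3_clique assms .
  \<comment> \<open>A linear \<open>D\<close> would make its subset \<open>C\<close> linear.\<close>
  have "{D. kclique 4 D \<and> \<not> linear_clique D \<and> C \<subseteq> D} = {D. kclique (Suc 3) D \<and> C \<subseteq> D}"
    using assms(2) linear_clique_subset by auto
  thus ?thesis using card_superclique[OF assms(1)] card_extensions_triangle[OF t(1)] t(2) by simp
qed

lemma card_extensions_4:
  fixes C :: "('a^5) set set set"
  assumes "(1::'a) \<notin> AS" "kclique 4 C" "\<not> linear_clique C"
  shows "card {D. kclique 5 D \<and> C \<subseteq> D} = 2"
proof -
  obtain X Y where XY: "extensions C = {X,Y}" "adjacent X Y"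
    using nonlinear_4_clique_extensions(2)[OF assms(2,3,1)] by blast
  hence "X \<noteq> Y" unfolding adjacent_def by blast
  thus ?thesis using card_superclique[OF assms(2)] XY by simp
qed

text \<open>The clique is a non-linear 4-clique \<open>K\<close> with one of its two extensions
  added. The other one is adjacent to it, and nothing else extends even \<open>K\<close>.\<close>

lemma card_extensions_5:
  fixes C :: "('a^5) set set set"
  assumes n: "(1::'a) \<notin> AS" and C: "kclique 5 C" "\<not> linear_clique C"
  shows "card {D. kclique 6 D \<and> C \<subseteq> D} = 1"
proof -
  have C': "clique C" "card C = 5" "finite C" using C(1) unfolding kclique_def by auto
  obtain K where K: "kclique 4 K" "\<not> linear_clique K" "K \<subseteq> C"
    using nonlinear_clique_cases[OF C'(1) C(2)] C'(2) by (auto simp: kclique_def)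
  have K': "finite K" "card K = 4" using K(1) unfolding kclique_def by auto
  obtain X Y where XY: "extensions K = {X,Y}" "adjacent X Y"
    using nonlinear_4_clique_extensions(2)[OF K(1,2) n] by blast
  have "card (C - K) = 1" using C' K K' by (simp add: card_Diff_subset)
  then obtain Z where Z: "C - K = {Z}" by (rule card_1_singletonE)
  hence CK: "C = insert Z K" using K(3) by blast
  have "Z \<in> extensions K" using clique_subset_extensions[OF C'(1) K(3)] Z by blast
  then obtain W where W: "extensions K = {Z,W}" "adjacent Z W"
    using XY adjacent_sym by (metis doubleton_eq_iff insert_iff singletonD)
  have ext: "extensions C = {W}"
  proof (intro equalityI subsetI)
    fix V assume V: "V \<in> extensions C"
    hence "clique (insert V K)" using clique_subset[of "insert V C" "insert V K"] K(3)
      unfolding extensions_def by blast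
    hence "V \<in> extensions K" using V K(3) unfolding extensions_def by blast
    thus "V \<in> {W}" using W V CK unfolding extensions_def by blast
  next
    fix V assume "V \<in> {W}"
    hence V: "V = W" by simp
    have WK: "W \<notin> K" "clique (insert W K)" "W \<noteq> Z"
      using W unfolding extensions_def adjacent_def by blast+
    have "clique (insert W (insert Z K))"
      using WK(2) C'(1) W(2) adjacent_sym unfolding CK clique_insert by blast
    thus "V \<in> extensions C" using WK unfolding V extensions_def CK by blast
  qed
  show ?thesis using card_superclique[OF C(1)] ext by simp
qed

text \<open>A non-linear 3-clique has \<open>q + 1\<close> extensions and so is not maximal.\<close>

lemma maximal_nonlinear_clique_contains_4:
  fixes C :: "('a^5) set set set"
  assumes "maximal_clique C" "\<not> linear_clique C"
  obtains K where "kclique 4 K" "\<not> linear_clique K" "K \<subseteq> C"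
proof -
  have C: "clique C" using assms(1) unfolding maximal_clique_def by blast
  show ?thesis
  proof (cases rule: nonlinear_clique_cases[OF C assms(2)])
    case 1
    then obtain a d e where t: "triangle a d e" "C = star a {d,e}"
      using nonlinear_3_clique assms(2) by blast
    hence "extensions C \<noteq> {}" using card_extensions_triangle by fastforce
    then obtain X where "X \<notin> C" "clique (insert X C)" unfolding extensions_def by blast
    thus ?thesis using assms(1) unfolding maximal_clique_def by blast
  qed (use that in blast)
qed

lemma maximal_nonlinear_clique_card_4:
  fixes C :: "('a^5) set set set"
  assumes "(1::'a) \<in> AS" "maximal_clique C" "\<not> linear_clique C"
  shows "card C = 4"
proof -
  obtain K where K: "kclique 4 K" "\<not> linear_clique K" "K \<subseteq> C"
    using maximal_nonlinear_clique_contains_4[OF assms(2,3)] .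
  have "clique C" using assms(2) unfolding maximal_clique_def by blast
  hence "C \<subseteq> K"
    using clique_subset_extensions[OF _ K(3)] nonlinear_4_clique_extensions(1)[OF K(1,2) assms(1)] by simp
  thus ?thesis using K unfolding kclique_def by (metis subset_antisym)
qed

text \<open>Beyond a non-linear 4-clique only its two extensions can occur. The bound later forces
  cliques of size \<open>q > 6\<close> to be linear.\<close>

lemma nonlinear_clique_card_le_6:
  fixes C :: "('a^5) set set set"
  assumes n: "(1::'a) \<notin> AS" and C: "clique C" "\<not> linear_clique C"
  shows "card C \<le> 6"
proof (cases rule: nonlinear_clique_cases[OF C])
  case 1
  thus ?thesis by (simp add: kclique_def)
next
  case (2 K)
  obtain X Y where XY: "extensions K = {X,Y}"
    using nonlinear_4_clique_extensions(2)[OF 2(1,2) n] by blast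
  have K: "card K = 4" "finite K" using 2(1) unfolding kclique_def by auto
  have "card C \<le> card (K \<union> {X,Y})"
    using clique_subset_extensions[OF C(1) 2(3)] XY K by (intro card_mono) auto
  also have "\<dots> \<le> card K + card {X,Y}" by (rule card_Un_le)
  also have "\<dots> \<le> 6" using K by (simp add: card_insert_if)
  finally show ?thesis .
qed

text \<open>The two extensions of \<open>K\<close> are adjacent, so together with \<open>K\<close>
  they form a clique; it contains \<open>C\<close>, and maximality gives equality.\<close>

lemma maximal_nonlinear_clique_card_6:
  fixes C :: "('a^5) set set set"
  assumes n: "(1::'a) \<notin> AS" and C: "maximal_clique C" "\<not> linear_clique C"
  shows "card C = 6"
proof -
  obtain K where K: "kclique 4 K" "\<not> linear_clique K" "K \<subseteq> C"
    using maximal_nonlinear_clique_contains_4[OF C] .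
  obtain X Y where XY: "extensions K = {X,Y}" "adjacent X Y"
    using nonlinear_4_clique_extensions(2)[OF K(1,2) n] by blast
  have X: "X \<notin> K" "Y \<notin> K" "X \<noteq> Y" "clique (insert X K)" "clique (insert Y K)"
    using XY unfolding extensions_def adjacent_def by blast+
  have "clique (insert X (insert Y K))"
    using X(4,5) XY(2) unfolding clique_insert by simp
  moreover have "clique C" using C(1) unfolding maximal_clique_def by blast
  hence "C \<subseteq> insert X (insert Y K)"
    using clique_subset_extensions[OF _ K(3)] XY(1) by auto
  ultimately have "C = insert X (insert Y K)" using C(1) unfolding maximal_clique_def by blast
  thus ?thesis using X K(1) unfolding kclique_def by simp
qed

end

section \<open>The standard model\<close>

type_synonym 'a quad = "'a \<times> 'a \<times> 'a \<times> 'a"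

fun scale4 :: "'a::field \<Rightarrow> 'a quad \<Rightarrow> 'a quad" where
  "scale4 c (x1,x2,x3,x4) = (c * x1, c * x2, c * x3, c * x4)"

fun form4 :: "'a::field quad \<Rightarrow> 'a" where
  "form4 (x1,x2,x3,x4) = x1 * x2 + x3 * x4"

fun bil4 :: "'a::field quad \<Rightarrow> 'a quad \<Rightarrow> 'a" where
  "bil4 (x1,x2,x3,x4) (y1,y2,y3,y4) = x1 * y2 + x2 * y1 + x3 * y4 + x4 * y3"

fun vec5 :: "'a::field \<Rightarrow> 'a quad \<Rightarrow> 'a^5" where
  "vec5 t (x1,x2,x3,x4) = (\<chi> i. if i = 0 then t else if i = 1 then x1 else if i = 2 then x2
     else if i = 3 then x3 else x4)"

text \<open>Exchanging the members of each hyperbolic pair turns \<open>bil4\<close> into the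
  coordinate dot product used by \<open>hyp\<close>.\<close>

fun swap4 :: "'a quad \<Rightarrow> 'a quad" where
  "swap4 (x1,x2,x3,x4) = (x2,x1,x4,x3)"

definition normal4 :: "'a::field quad \<Rightarrow> 'a^5" where
  "normal4 a = vec5 1 (swap4 a)"

lemma UNIV_5: "(UNIV :: 5 set) = {0,1,2,3,4}"
proof (rule sym, rule card_seteq)
  show "card (UNIV :: 5 set) \<le> card {0,1,2,3,4::5}" by simp
qed simp_all

lemma forall_5: "(\<forall>i::5. P i) \<longleftrightarrow> P 0 \<and> P 1 \<and> P 2 \<and> P 3 \<and> P 4"
proof -
  have "(\<forall>i::5. P i) \<longleftrightarrow> (\<forall>i\<in>{0,1,2,3,4}. P i)" unfolding UNIV_5[symmetric] by simp
  thus ?thesis by simp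
qed

lemma sum_5: "sum f (UNIV :: 5 set) = f 0 + f 1 + f 2 + f 3 + f 4"
  unfolding UNIV_5 by (simp add: add.assoc)

lemma vec5_nth [simp]:
  "vec5 t (x1,x2,x3,x4) $ 0 = t" "vec5 t (x1,x2,x3,x4) $ 1 = x1" "vec5 t (x1,x2,x3,x4) $ 2 = x2"
  "vec5 t (x1,x2,x3,x4) $ 3 = x3" "vec5 t (x1,x2,x3,x4) $ 4 = x4"
  by simp_all

declare vec5.simps [simp del]

lemma vec5_eq_iff: "vec5 s x = vec5 t y \<longleftrightarrow> s = t \<and> x = y"
  by (cases x; cases y) (simp add: vec_eq_iff forall_5)

lemma smult_vec5: "smult c (vec5 t x) = vec5 (c * t) (scale4 c x)"
  by (cases x) (simp add: vec_eq_iff forall_5 smult_def)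

lemma vadd_vec5: "vadd (vec5 s x) (vec5 t y) = vec5 (s + t) (x + y)"
  by (cases x; cases y) (simp add: vec_eq_iff forall_5 vadd_def)

lemma vec5_eq_0_iff: "vec5 t x = 0 \<longleftrightarrow> t = 0 \<and> x = 0"
  by (cases x) (simp add: vec_eq_iff forall_5 zero_prod_def)

lemma Qform_vec5: "Qform (vec5 t x) = t^2 + form4 x"
  by (cases x) (simp add: Qform_def power2_eq_square)

lemma quadratic_space_4:
  assumes two: "(1::'a::{field,finite}) + 1 = 0"
  shows "quadratic_space scale4 form4 (bil4 :: 'a quad \<Rightarrow> 'a quad \<Rightarrow> 'a)"
proof unfold_locales
  fix x :: "'a quad" assume x: "x \<noteq> 0"
  obtain x1 x2 x3 x4 where [simp]: "x = (x1,x2,x3,x4)" by (cases x)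
  have "x1 \<noteq> 0 \<or> x2 \<noteq> 0 \<or> x3 \<noteq> 0 \<or> x4 \<noteq> 0" using x by (auto simp: zero_prod_def)
  moreover have "bil4 x (0,1,0,0) = x1" "bil4 x (1,0,0,0) = x2" "bil4 x (0,0,0,1) = x3"
    "bil4 x (0,0,1,0) = x4" by simp_all
  ultimately show "\<exists>y. bil4 x y \<noteq> 0" by metis
next
  show "CARD('a quad) = CARD('a) ^ 4" by (simp add: power4_eq_xxxx mult.assoc)
next
  show "(1::'a) + 1 = 0" by (rule two)
qed (auto simp: algebra_simps power2_eq_square)

text \<open>Twisting by \<open>(1, k, 0, 0)\<close> turns the first hyperbolic plane into the form
  \<open>x2^2 + x1 x2 + k^2 x1^2\<close>, anisotropic because \<open>k^2\<close> is not in
  \<open>AS\<close>. An anisotropic plane plus a hyperbolic plane is elliptic.\<close>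

lemma ex_vertex_4:
  assumes two: "(1::'a::{field,finite}) + 1 = 0"
  shows "\<exists>a :: 'a quad. quadratic_space.vertex scale4 form4 bil4 a"
proof -
  interpret quadratic_space scale4 form4 "bil4 :: 'a quad \<Rightarrow> 'a quad \<Rightarrow> 'a"
    by (rule quadratic_space_4[OF two])
  obtain k :: 'a where k: "k \<notin> AS" using ex_not_AS by blast
  define a :: "'a quad" where "a = (1, k, 0, 0)"
  have tw: "twist a (x1,x2,x3,x4) = x1 * x2 + (x2 + k * x1)^2 + x3 * x4" for x1 x2 x3 x4
    by (simp add: twist_def a_def algebra_simps)
  have aniso: "x1 * x2 + (x2 + k * x1)^2 = 0 \<Longrightarrow> x1 = 0 \<and> x2 = 0" for x1 x2
  proof (cases "x1 = 0")
    case False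
    define z where "z = x2 / x1"
    have x2: "x2 = x1 * z" using False by (simp add: z_def)
    assume "x1 * x2 + (x2 + k * x1)^2 = 0"
    moreover have "x1 * x2 + (x2 + k * x1)^2 = x1^2 * ((z^2 + z) + k^2)"
      unfolding x2 by (simp add: square_sum power_mult_distrib algebra_simps power2_eq_square)
    ultimately have "z^2 + z = k^2" using False by simp
    hence "k^2 \<in> AS" using AS_I[of z] by simp
    thus ?thesis using k AS_square by blast
  qed simp
  have pt: "\<exists>t. z = (0,0,0,t)" if z: "twist a z = 0" "z = (z1,z2,0,z4)" for z z1 z2 z4
    using aniso[of z1 z2] z by (simp add: tw)
  have "vertex a"
    unfolding vertex_iff
  proof (intro allI impI)
    fix x y assume xy: "twist a x = 0" "twist a y = 0" "bil4 x y = 0" "x \<noteq> 0"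
    obtain x1 x2 x3 x4 where x: "x = (x1,x2,x3,x4)" by (cases x)
    obtain y1 y2 y3 y4 where y: "y = (y1,y2,y3,y4)" by (cases y)
    \<comment> \<open>This combination has third coordinate 0 and is again singular, so
      \<open>pt\<close> puts it on the last axis. Its product with \<open>x\<close> is
      \<open>x3 * t\<close>, hence it vanishes unless \<open>x3 = 0\<close>.\<close>
    define z where "z = scale4 y3 x + scale4 x3 y"
    have "twist a z = 0"
      using xy by (simp add: z_def twist_add_right twist_scale B_lin del: bil4.simps)
    moreover have "z = (y3 * x1 + x3 * y1, y3 * x2 + x3 * y2, 0, y3 * x4 + x3 * y4)"
      by (simp add: z_def x y mult.commute)
    ultimately obtain t where t: "z = (0,0,0,t)" using pt by blast
    have "bil4 x z = 0" "bil4 y z = 0"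
      using xy(3) B_sym[of x y] by (simp_all add: z_def B_lin del: bil4.simps)
    hence tt: "x3 * t = 0" "y3 * t = 0" unfolding t x y by simp_all
    show "\<exists>c. y = scale4 c x"
    proof (cases "x3 = 0")
      case True
      then obtain s where s: "x = (0,0,0,s)" using pt[OF xy(1)] x by blast
      hence "s \<noteq> 0" using xy(4) by (auto simp: zero_prod_def)
      moreover have "y3 * s = 0" using xy(3) unfolding s y by (simp add: mult.commute)
      ultimately have "y3 = 0" by simp
      then obtain r where "y = (0,0,0,r)" using pt[OF xy(2)] y by blast
      hence "y = scale4 (r / s) x" using s \<open>s \<noteq> 0\<close> by simp
      thus ?thesis ..
    next
      case False
      hence "t = 0" using tt by simp
      hence "scale4 y3 x + scale4 x3 y = 0" using t by (simp add: z_def zero_prod_def)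
      hence "scale4 y3 x = scale4 x3 y" by simp
      hence "scale4 (inverse x3) (scale4 x3 y) = scale4 (inverse x3) (scale4 y3 x)" by simp
      hence "y = scale4 (inverse x3 * y3) x" using False by simp
      thus ?thesis ..
    qed
  qed
  thus ?thesis ..
qed

lemma ovoid_coordinates_4:
  assumes two: "(1::'a::{field,finite}) + 1 = 0"
  shows "ovoid_coordinates scale4 form4 (bil4 :: 'a quad \<Rightarrow> 'a quad \<Rightarrow> 'a) vec5 normal4"
proof -
  interpret quadratic_space scale4 form4 "bil4 :: 'a quad \<Rightarrow> 'a quad \<Rightarrow> 'a"
    by (rule quadratic_space_4[OF two])
  have surj: "\<exists>t x. v = vec5 t x" for v :: "'a^5"
  proof -
    have "v = vec5 (v$0) (v$1,v$2,v$3,v$4)" by (simp add: vec_eq_iff forall_5)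
    thus ?thesis by blast
  qed
  show ?thesis
  proof unfold_locales
    fix c t :: 'a and x a :: "'a quad" assume "c \<noteq> 0"
    obtain x1 x2 x3 x4 where x: "x = (x1,x2,x3,x4)" by (cases x)
    obtain a1 a2 a3 a4 where a: "a = (a1,a2,a3,a4)" by (cases a)
    have "vec5 t x \<in> hyp (smult c (normal4 a)) \<longleftrightarrow> c * (t + bil4 a x) = 0"
      by (simp add: hyp_def sum_5 x a normal4_def smult_vec5 algebra_simps)
    thus "vec5 t x \<in> hyp (smult c (normal4 a)) \<longleftrightarrow> t = bil4 a x" using \<open>c \<noteq> 0\<close> by simp
  next
    fix v :: "'a^5"
    obtain t x where "v = vec5 t x" using surj by blast
    then obtain x1 x2 x3 x4 where v: "v = vec5 t (x1,x2,x3,x4)" by (cases x) blast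
    show "(\<exists>c a. c \<noteq> 0 \<and> v = smult c (normal4 a)) \<or> vec5 1 0 \<in> hyp v"
    proof (cases "t = 0")
      case True
      thus ?thesis by (simp add: hyp_def sum_5 v zero_prod_def)
    next
      case False
      \<comment> \<open>Scale the first coordinate to 1 and undo the exchange made by
        \<open>swap4\<close>.\<close>
      hence "v = smult t (normal4 (x2 / t, x1 / t, x4 / t, x3 / t))"
        by (simp add: v normal4_def smult_vec5)
      thus ?thesis using False by blast
    qed
  qed (use surj ex_vertex_4[OF two] in \<open>simp_all only: vec5_eq_iff smult_vec5 vadd_vec5 vec5_eq_0_iff Qform_vec5\<close>)
qed

theorem theorem2:
  fixes n :: nat
  assumes q: "CARD('a::{field,finite}) = 2 ^ n"
  shows
   "(even n \<longrightarrow>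
      (\<forall>C::('a^5) set set set. maximal_clique C \<longrightarrow>
          (finite C \<and> (card C = 2 ^ n \<or> card C = 4))) \<and>
      (2 ^ n > (4::nat) \<longrightarrow>
        (\<forall>C::('a^5) set set set. maximal_clique C \<and> finite C \<and> card C = 2 ^ n \<longrightarrow> linear_clique C) \<and>
        (\<forall>C::('a^5) set set set. maximal_clique C \<and> finite C \<and> card C = 4 \<longrightarrow> \<not> linear_clique C)))
  \<and> (odd n \<and> 2 ^ n > (2::nat) \<longrightarrow>
      (\<forall>C::('a^5) set set set. maximal_clique C \<longrightarrow>
          (finite C \<and> (card C = 2 ^ n \<or> card C = 6))) \<and>
      (\<forall>C::('a^5) set set set. kclique (2 ^ n) C \<longrightarrow> linear_clique C) \<and>
      (\<forall>C::('a^5) set set set. maximal_clique C \<and> finite C \<and> card C = 6 \<longrightarrow> \<not> linear_clique C))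
  \<and> (\<forall>C::('a^5) set set set. kclique 3 C \<and> \<not> linear_clique C \<longrightarrow>
        card {D. kclique 4 D \<and> \<not> linear_clique D \<and> C \<subseteq> D} = 2 ^ n + 1)
  \<and> (odd n \<longrightarrow>
      (\<forall>C::('a^5) set set set. kclique 4 C \<and> \<not> linear_clique C \<longrightarrow>
        card {D. kclique 5 D \<and> C \<subseteq> D} = 2) \<and>
      (\<forall>C::('a^5) set set set. kclique 5 C \<and> \<not> linear_clique C \<longrightarrow>
        card {D. kclique 6 D \<and> C \<subseteq> D} = 1))"
proof -
  have two: "(1::'a) + 1 = 0" by (rule one_plus_one_eq_0[OF q])
  interpret ovoid_coordinates scale4 form4 "bil4 :: 'a quad \<Rightarrow> 'a quad \<Rightarrow> 'a" vec5 normal4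
    by (rule ovoid_coordinates_4[OF two])
  note AS_iff = one_in_artin_schreier_iff[OF q]
  have linear: "card C = 2 ^ n" if "maximal_clique C" "linear_clique C" for C :: "('a^5) set set set"
    using maximal_linear_clique_card[OF that] q by simp
  have finite: "finite C" for C :: "('a^5) set set set" by simp
  have four: "card C = 4" if "even n" "maximal_clique C" "\<not> linear_clique C" for C :: "('a^5) set set set"
    using maximal_nonlinear_clique_card_4[OF _ that(2,3)] AS_iff that(1) by simp
  have six: "card C = 6" if "odd n" "maximal_clique C" "\<not> linear_clique C" for C :: "('a^5) set set set"
    using maximal_nonlinear_clique_card_6[OF _ that(2,3)] AS_iff that(1) by simp
  \<comment> \<open>Non-linear cliques have at most six members, while here \<open>n\<close> is at
    least 3 and \<open>q\<close> at least 8.\<close>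
  have big: "linear_clique C" if n: "odd n" "2 ^ n > (2::nat)" and C: "kclique (2 ^ n) C"
    for C :: "('a^5) set set set"
  proof (rule ccontr)
    assume "\<not> linear_clique C"
    hence "(2::nat) ^ n \<le> 6"
      using nonlinear_clique_card_le_6[of C] AS_iff n C unfolding kclique_def by simp
    moreover have "n \<noteq> 0" using n(1) by (metis even_zero)
    moreover have "n \<noteq> 1" "n \<noteq> 2" using n by auto
    ultimately have "n \<ge> 3" "(2::nat) ^ n \<le> 6" by linarith+
    thus False using power_increasing[of 3 n "2::nat"] by simp
  qed
  \<comment> \<open>No power of two is divisible by 3. Hence a maximal clique of size 6 cannot have
    the size \<open>q\<close> of a maximal linear one.\<close>
  have not_6: "2 ^ n \<noteq> (6::nat)"
  proof
    assume "2 ^ n = (6::nat)"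
    thus False using two_power_mod_3[of n] by (simp split: if_splits)
  qed
  show ?thesis
  proof (intro conjI impI allI; (elim conjE)?)
    fix C :: "('a^5) set set set"
    show "finite C" "finite C" by (rule finite)+
    show "card C = 2 ^ n \<or> card C = 4" if "even n" "maximal_clique C"
      using that linear four by blast
    show "linear_clique C" if "even n" "2 ^ n > (4::nat)" "maximal_clique C" "card C = 2 ^ n"
      using that four[of C] by force
    show "\<not> linear_clique C" if "2 ^ n > (4::nat)" "maximal_clique C" "card C = 4"
      using that linear[of C] by force
    show "card C = 2 ^ n \<or> card C = 6" if "odd n" "maximal_clique C"
      using that linear six by blast
    show "linear_clique C" if "odd n" "2 ^ n > (2::nat)" "kclique (2 ^ n) C"
      using that by (rule big)
    show "\<not> linear_clique C" if "maximal_clique C" "card C = 6"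
      using that linear[of C] not_6 by force
    show "card {D. kclique 4 D \<and> \<not> linear_clique D \<and> C \<subseteq> D} = 2 ^ n + 1"
      if "kclique 3 C" "\<not> linear_clique C"
      using card_nonlinear_extensions_3[OF that] q by simp
    show "card {D. kclique 5 D \<and> C \<subseteq> D} = 2" if "odd n" "kclique 4 C" "\<not> linear_clique C"
      using card_extensions_4[OF _ that(2,3)] AS_iff that(1) by simp
    show "card {D. kclique 6 D \<and> C \<subseteq> D} = 1" if "odd n" "kclique 5 C" "\<not> linear_clique C"
      using card_extensions_5[OF _ that(2,3)] AS_iff that(1) by simp
  qed
qed

end
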